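(* Assume: (1) $\partial_x L,\partial_a L:\mathbb{R}^d\times\mathbb{R}^d\times\mathcal{P}_2(\mathbb{R}^{2d})\to\mathbb{R}^d$ exist and are uniformly Lipschitz continuous in $(x,a,\rho)$ with constant $C_{Lip}$, with respect to $\mathrm{W}_1$ in $\rho$. (2) (i) There is $c_0>0$ such that for all $x,a_1,a_2\in\mathbb{R}^d$, $\rho\in\mathcal{P}_2(\mathbb{R}^{2d})$, $L(x,a_2,\rho)-L(x,a_1,\rho)-\partial_aL(x,a_1,\rho)\cdot(a_2-a_1)\ge\frac{c_0}{2}|a_2-a_1|^2$. (ii) There are $c_1<c_0$ and $C>0$ such that for all $x,a\in\mathbb{R}^d$ and all square-integrable $\mathbb{R}^d$-valued random variables $X^1,X^2,\alpha^1,\alpha^2$, $|\partial_aL(x,a,\mathcal{L}(X^1,\alpha^1))-\partial_aL(x,a,\mathcal{L}(X^2,\alpha^2))|\le C\mathbb{E}[|X^1-X^2|]+c_1\mathbb{E}[|\alpha^1-\alpha^2|]$. (3) There is $C>0$ such that for all $(x,a,\rho)\in\mathbb{R}^d\times\mathbb{R}^d\times\mathcal{P}_2(\mathbb{R}^{2d})$, $$\frac1C|a|^2-C\big(1+|x|^2+\mathrm{W}_2(\rho,\delta_{(0,0)})\big)\le L(x,a,\rho)\le C|a|^2+C\big(1+|x|^2+\mathrm{W}_2(\rho,\delta_{(0,0)})\big).$$ Then the fixed-point equation $\rho=\mathcal{L}\big(X,\partial_pH(X,Y,\rho)\big)$ uniquely defines a $\mathrm{W}_1$-Lipschitz continuous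 map $\Phi:\mathcal{P}_2(\mathbb{R}^{2d})\to\mathcal{P}_2(\mathbb{R}^{2d})$: for every $\nu=\mathcal{L}(X,Y)\in\mathcal{P}_2(\mathbb{R}^{2d})$ the map $\rho\mapsto\mathcal{L}(X,\partial_pH(X,Y,\rho))$ on $\mathcal{P}_2(\mathbb{R}^{2d})$ has a unique fixed point $\Phi(\nu)$, and there is a constant $C'$ with $\mathrm{W}_1(\Phi(\nu^1),\Phi(\nu^2))\le C'\,\mathrm{W}_1(\nu^1,\nu^2)$ for all $\nu^1,\nu^2\in\mathcal{P}_2(\mathbb{R}^{2d})$.
   Context: $L:\mathbb{R}^d\times\mathbb{R}^d\times\mathcal{P}_2(\mathbb{R}^{2d})\to\mathbb{R}$ is the Lagrangian and $H(x,p,\rho)=\inf_{a\in\mathbb{R}^d}\{p\cdot a+L(x,a,\rho)\}$ the Hamiltonian. $\mathcal{P}_2(\mathbb{R}^{2d})$ is the set of probability measures on $\mathbb{R}^{2d}$ with finite second moment, $\mathrm{W}_p$ the $p$-Wasserstein distance, $\mathcal{L}(\cdot)$ the law of a random variable; $X,Y$ are $\mathbb{R}^d$-valued square-integrable random variables on an atomless probability space. *)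

theory Defs
  imports "HOL-Probability.Probability"
begin

definition P2 :: "'b::real_normed_vector measure set" where
  "P2 = {\<mu>. prob_space \<mu> \<and> sets \<mu> = sets borel \<and> integrable \<mu> (\<lambda>z. (norm z)\<^sup>2)}"

definition couplings :: "'b measure \<Rightarrow> 'b measure \<Rightarrow> ('b \<times> 'b) measure set" where
  "couplings \<mu> \<nu> = {\<pi>. sets \<pi> = sets (\<mu> \<Otimes>\<^sub>M \<nu>) \<and> distr \<pi> \<mu> fst = \<mu> \<and> distr \<pi> \<nu> snd = \<nu>}"

text \<open>The transport cost is an extended nonnegative number, so a non-integrable cost counts as
  infinite. For measures in \<^const>\<open>P2\<close> and exponents 1 and 2 the infimum is finite, so that
  \<^const>\<open>enn2real\<close> loses nothing there.\<close>

definition wasserstein :: "real \<Rightarrow> 'b::metric_space measure \<Rightarrow> 'b measure \<Rightarrow> real" where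
  "wasserstein p \<mu> \<nu> =
     (enn2real (INF \<pi>\<in>couplings \<mu> \<nu>. \<integral>\<^sup>+ z. ennreal (dist (fst z) (snd z) powr p) \<partial>\<pi>)) powr (1 / p)"

definition atomless_prob_space :: "'w measure \<Rightarrow> bool" where
  "atomless_prob_space M \<longleftrightarrow> prob_space M \<and>
     (\<forall>A\<in>sets M. 0 < measure M A \<longrightarrow>
        (\<exists>B\<in>sets M. B \<subseteq> A \<and> 0 < measure M B \<and> measure M B < measure M A))"

definition square_integrable :: "'w measure \<Rightarrow> ('w \<Rightarrow> 'b::real_normed_vector) \<Rightarrow> bool" where
  "square_integrable M X \<longleftrightarrow> X \<in> borel_measurable M \<and> integrable M (\<lambda>\<omega>. (norm (X \<omega>))\<^sup>2)"

abbreviation law :: "'w measure \<Rightarrow> ('w \<Rightarrow> 'b::topological_space) \<Rightarrow> 'b measure" where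
  "law M X \<equiv> distr M borel X"

definition grad :: "('b::real_inner \<Rightarrow> real) \<Rightarrow> 'b \<Rightarrow> 'b" where
  "grad f x = (THE D. GDERIV f x :> D)"

text \<open>A measure on the product type stands for a measure on \<open>\<real>\<^sup>2\<^sup>d\<close>; the norm of the product type
  is the Euclidean one. Only the values of a Lagrangian at measures in \<^const>\<open>P2\<close> are meaningful.\<close>

type_synonym 'd lagrangian =
  "real^'d \<Rightarrow> real^'d \<Rightarrow> ((real^'d) \<times> (real^'d)) measure \<Rightarrow> real"

definition Lx :: "'d::finite lagrangian \<Rightarrow> real^'d \<Rightarrow> real^'d \<Rightarrow> ((real^'d) \<times> (real^'d)) measure \<Rightarrow> real^'d" where
  "Lx L x a \<rho> = grad (\<lambda>x'. L x' a \<rho>) x"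

definition La :: "'d::finite lagrangian \<Rightarrow> real^'d \<Rightarrow> real^'d \<Rightarrow> ((real^'d) \<times> (real^'d)) measure \<Rightarrow> real^'d" where
  "La L x a \<rho> = grad (\<lambda>a'. L x a' \<rho>) a"

text \<open>This is an infimum in the reals, meaningful only if the set is bounded below, as it is
  for a Lagrangian that is strongly convex in \<open>a\<close>.\<close>

definition hamiltonian :: "'d::finite lagrangian \<Rightarrow> 'd lagrangian" where
  "hamiltonian L x p \<rho> = (INF a. p \<bullet> a + L x a \<rho>)"

definition Hp :: "'d::finite lagrangian \<Rightarrow> real^'d \<Rightarrow> real^'d \<Rightarrow> ((real^'d) \<times> (real^'d)) measure \<Rightarrow> real^'d" where
  "Hp L x p \<rho> = grad (\<lambda>p'. hamiltonian L x p' \<rho>) p"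

end

theory Submission imports Defs begin

text \<open>
  Fix a measure \<open>\<rho>\<close>. By strong convexity in the control, the infimum that defines the Hamiltonian is
  attained at the unique solution \<open>a\<close> of \<open>p + \<partial>\<^sub>aL(x, a, \<rho>) = 0\<close>, and by the envelope theorem
  (\<open>legendre_GDERIV\<close>) this minimiser is \<open>\<partial>\<^sub>pH(x, p, \<rho>)\<close>. Strong monotonicity of \<open>\<partial>\<^sub>aL\<close> with constant \<open>c\<^sub>0\<close> turns
  every perturbation of the first-order condition into one of the minimiser, divided by \<open>c\<^sub>0\<close>
  (\<open>legendre_grad_stability\<close>).

  Given \<open>X\<close> and \<open>Y\<close>, a measure \<open>\<rho>\<close> solves the equation exactly if \<open>\<rho>\<close> is the law of \<open>(X, \<alpha>)\<close> with
  \<open>\<alpha> = \<partial>\<^sub>pH(X, Y, \<rho>)\<close>, that is, if \<open>\<alpha>\<close> is a fixed point of the map that sends \<open>\<alpha>\<close> to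
  \<open>\<partial>\<^sub>pH(X, Y, Law(X, \<alpha>))\<close>. Two images under this map differ, at each sample point, by at most
  \<open>max c\<^sub>1 0 / c\<^sub>0 < 1\<close> times the mean distance of the arguments. Hence the map contracts, and it has
  exactly one square-integrable fixed point (\<open>uniform_contraction_fixed_point\<close>). If \<open>X\<close> and \<open>Y\<close> change as
  well, the same estimate bounds the mean distance of the two fixed points by that of the data
  (\<open>best_response_fixed_points_dist\<close>).

  To pass from random variables to measures, every law, and every coupling of two laws, has to be
  realised on the given space. This is where atomlessness enters (\<open>atomless_obtains_law\<close>): a maximal chain
  of measurable sets takes every measure in \<open>[0, 1]\<close> and hence yields a uniform variable, and a
  Borel encoding of a separable Banach space into the reals reduces arbitrary laws to quantile transforms. Taking
  the infimum over all realised couplings (\<open>le_wasserstein_1\<close>) then gives the Lipschitz estimate for the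
  1-Wasserstein distance.
\<close>

section \<open>Random variables with prescribed law on an atomless space\<close>

text \<open>An uncountable union of measurable sets need not be measurable. In a chain whose members are told
  apart by their measures, however, a sequence of members whose measures approach the supremum is
  cofinal, so the union is a countable one.\<close>

lemma chain_Union_measure_le:
  assumes "finite_measure M" and meas: "\<C> \<subseteq> sets M"
    and chain: "\<And>A B. A \<in> \<C> \<Longrightarrow> B \<in> \<C> \<Longrightarrow> A \<subseteq> B \<or> B \<subseteq> A"
    and strict: "inj_on (measure M) \<C>"
    and bound: "\<And>A. A \<in> \<C> \<Longrightarrow> measure M A \<le> t" and "0 \<le> t"
  shows "\<Union>\<C> \<in> sets M" and "measure M (\<Union>\<C>) \<le> t"
proof -
  interpret finite_measure M by fact
  have mono: "measure M A \<le> measure M B" if "A \<subseteq> B" "B \<in> \<C>" for A B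
    using that meas by (intro finite_measure_mono) auto
  have "\<Union>\<C> \<in> sets M \<and> measure M (\<Union>\<C>) \<le> t"
  proof (cases "\<C> = {}")
    case False
    define s where "s = Sup (measure M ` \<C>)"
    have bdd: "bdd_above (measure M ` \<C>)"
      using bound by (auto intro!: bdd_aboveI)
    have le_s: "measure M A \<le> s" if "A \<in> \<C>" for A
      unfolding s_def using that bdd by (intro cSup_upper) auto
    show ?thesis
    proof (cases "\<exists>A\<in>\<C>. measure M A = s")
      case True
      then obtain A where A: "A \<in> \<C>" "measure M A = s" by blast
      have "B \<subseteq> A" if "B \<in> \<C>" for B
        using chain[OF that A(1)] mono[of A B] le_s[OF that] inj_onD[OF strict, of A B] A that
        by fastforce
      with A have "\<Union>\<C> = A" by blast
      with A meas bound show ?thesis by auto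
    next
      case False
      have "\<exists>A\<in>\<C>. s - inverse (real (Suc n)) < measure M A" for n
      proof -
        have "s - inverse (real (Suc n)) < s" by simp
        then show ?thesis
          unfolding s_def using less_cSup_iff[OF _ bdd] \<open>\<C> \<noteq> {}\<close> by auto
      qed
      then obtain A where A: "\<And>n. A n \<in> \<C>" "\<And>n. s - inverse (real (Suc n)) < measure M (A n)"
        by metis
      \<comment> \<open>The running unions stay inside the chain, because two members are always nested.\<close>
      define B where "B n = (\<Union>i\<le>n. A i)" for n
      have B: "B n \<in> \<C>" for n
      proof (induction n)
        case (Suc n)
        have "B (Suc n) = B n \<union> A (Suc n)"
          by (auto simp: B_def atMost_Suc)
        then show ?case
          using chain[OF Suc A(1)[of "Suc n"]] Suc A(1)[of "Suc n"] by (metis sup.absorb1 sup.absorb2)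
      qed (use A in \<open>auto simp: B_def\<close>)
      have "D \<subseteq> (\<Union>n. B n)" if D: "D \<in> \<C>" for D
      proof -
        have "measure M D < s" using le_s[OF D] False D by force
        then obtain n where "inverse (real (Suc n)) < s - measure M D"
          using reals_Archimedean[of "s - measure M D"] by auto
        then have "\<not> A n \<subseteq> D" using A(2)[of n] mono[of "A n" D] D by fastforce
        then have "D \<subseteq> A n" using chain[OF D A(1)] by blast
        then show ?thesis by (auto simp: B_def)
      qed
      then have eq: "\<Union>\<C> = (\<Union>n. B n)" using B by blast
      have "(\<lambda>n. measure M (B n)) \<longlonglongrightarrow> measure M (\<Union>n. B n)"
        using B meas by (intro finite_Lim_measure_incseq) (auto simp: incseq_def B_def, force)
      then have "measure M (\<Union>n. B n) \<le> t"
        using B bound by (intro LIMSEQ_le_const2) auto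
      moreover have "(\<Union>n. B n) \<in> sets M" using B meas by blast
      ultimately show ?thesis using eq by simp
    qed
  qed (use \<open>0 \<le> t\<close> in auto)
  then show "\<Union>\<C> \<in> sets M" and "measure M (\<Union>\<C>) \<le> t" by auto
qed

lemma (in prob_space) chain_Inter_measure_ge:
  assumes meas: "\<C> \<subseteq> sets M"
    and chain: "\<And>A B. A \<in> \<C> \<Longrightarrow> B \<in> \<C> \<Longrightarrow> A \<subseteq> B \<or> B \<subseteq> A"
    and strict: "inj_on (measure M) \<C>"
    and bound: "\<And>A. A \<in> \<C> \<Longrightarrow> t \<le> measure M A" and "t \<le> 1"
  shows "space M - (\<Union>A\<in>\<C>. space M - A) \<in> sets M"
    and "t \<le> measure M (space M - (\<Union>A\<in>\<C>. space M - A))"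
proof -
  let ?D = "(\<lambda>A. space M - A) ` \<C>"
  have compl: "measure M (space M - A) = 1 - measure M A" if "A \<in> \<C>" for A
    using prob_compl[of A] that meas by auto
  have *: "?D \<subseteq> sets M" "\<And>A B. A \<in> ?D \<Longrightarrow> B \<in> ?D \<Longrightarrow> A \<subseteq> B \<or> B \<subseteq> A"
    "inj_on (measure M) ?D" "\<And>A. A \<in> ?D \<Longrightarrow> measure M A \<le> 1 - t"
  proof -
    show "?D \<subseteq> sets M" using meas by auto
    show "A \<subseteq> B \<or> B \<subseteq> A" if AB: "A \<in> ?D" "B \<in> ?D" for A B
    proof -
      obtain A' B' where "A = space M - A'" "B = space M - B'" "A' \<in> \<C>" "B' \<in> \<C>"
        using AB by blast
      then show ?thesis using chain[of A' B'] by blast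
    qed
    show "inj_on (measure M) ?D"
      using strict by (auto simp: inj_on_def compl)
    show "measure M A \<le> 1 - t" if "A \<in> ?D" for A
      using that bound by (auto simp: compl)
  qed
  have U: "\<Union>?D \<in> sets M" "measure M (\<Union>?D) \<le> 1 - t"
    by (rule chain_Union_measure_le[OF finite_measure_axioms *]; use \<open>t \<le> 1\<close> in simp)+
  then show "space M - \<Union>?D \<in> sets M" by auto
  show "t \<le> measure M (space M - \<Union>?D)" using U prob_compl[OF U(1)] by simp
qed

text \<open>Take a maximal chain for the order ``contained in, and of strictly smaller measure''; strictness
  excludes modifications by null sets. If the value \<open>t\<close> were skipped, the union \<open>E\<close> of the members
  below \<open>t\<close> and the intersection \<open>F\<close> of those above would leave room for another member: \<open>E\<close> or \<open>F\<close>
  itself if it has measure \<open>t\<close>, and otherwise \<open>E\<close> together with a piece of \<open>F - E\<close>, which exists as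
  there are no atoms.\<close>

lemma atomless_obtains_chain:
  assumes "atomless_prob_space M"
  obtains A :: "real \<Rightarrow> 'w set"
  where "\<And>t. t \<in> {0..1} \<Longrightarrow> A t \<in> sets M" "\<And>t. t \<in> {0..1} \<Longrightarrow> measure M (A t) = t"
    "mono_on {0..1} A"
proof -
  interpret prob_space M using assms by (simp add: atomless_prob_space_def)
  have split: "\<exists>B\<in>sets M. B \<subseteq> A \<and> 0 < prob B \<and> prob B < prob A" if "A \<in> sets M" "0 < prob A" for A
    using assms that by (auto simp: atomless_prob_space_def)
  define P where "P A B \<longleftrightarrow> A \<subseteq> B \<and> prob A < prob B" for A B
  obtain \<C> where "pred_on.maxchain (sets M) P \<C>"
    using pred_on.Hausdorff by blast
  then have "pred_on.chain (sets M) P \<C>"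
    and max: "\<And>\<D>. pred_on.chain (sets M) P \<D> \<Longrightarrow> \<not> \<C> \<subset> \<D>"
    unfolding pred_on.maxchain_def by blast+
  then have meas: "\<C> \<subseteq> sets M"
    and comp: "\<And>A B. A \<in> \<C> \<Longrightarrow> B \<in> \<C> \<Longrightarrow> A = B \<or> P A B \<or> P B A"
    unfolding pred_on.chain_def by blast+
  have max': "D \<in> \<C>" if "D \<in> sets M" "\<And>A. A \<in> \<C> \<Longrightarrow> P A D \<or> P D A" for D
  proof -
    have "pred_on.chain (sets M) P (insert D \<C>)"
      unfolding pred_on.chain_def using meas comp that by auto
    with max show ?thesis by blast
  qed
  have chain: "A \<subseteq> B \<or> B \<subseteq> A" if "A \<in> \<C>" "B \<in> \<C>" for A B
    using comp[OF that] by (auto simp: P_def)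
  have inj: "inj_on prob \<C>"
    using comp by (force simp: inj_on_def P_def)
  have "\<exists>A\<in>\<C>. prob A = t" if t: "t \<in> {0..1}" for t
  proof (rule ccontr)
    assume none: "\<not> (\<exists>A\<in>\<C>. prob A = t)"
    define E where "E = \<Union>{A\<in>\<C>. prob A < t}"
    define F where "F = space M - (\<Union>A\<in>{A\<in>\<C>. t < prob A}. space M - A)"
    have E: "E \<in> sets M" "prob E \<le> t"
      unfolding E_def
      by (rule chain_Union_measure_le[OF finite_measure_axioms];
          use t meas chain inj in \<open>auto intro: inj_on_subset\<close>)+
    have F: "F \<in> sets M" "t \<le> prob F"
      unfolding F_def
      by (rule chain_Inter_measure_ge; use t meas chain inj in \<open>auto intro: inj_on_subset\<close>)+
    have lower: "A \<subseteq> E" if "A \<in> \<C>" "prob A < t" for A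
      using that by (auto simp: E_def)
    have upper: "F \<subseteq> A" if "A \<in> \<C>" "t < prob A" for A
      using that meas by (auto simp: F_def)
    have EF: "E \<subseteq> F"
    proof -
      have "A \<subseteq> B" if "A \<in> \<C>" "prob A < t" "B \<in> \<C>" "t < prob B" for A B
        using comp[of A B] that by (auto simp: P_def)
      moreover have "A \<subseteq> space M" if "A \<in> \<C>" for A
        using that meas sets.sets_into_space by blast
      ultimately show ?thesis unfolding E_def F_def by blast
    qed
    have absurd: False if D: "D \<in> sets M" "E \<subseteq> D" "D \<subseteq> F"
      and strictE: "\<And>A. A \<in> \<C> \<Longrightarrow> prob A < t \<Longrightarrow> prob A < prob D"
      and strictF: "\<And>A. A \<in> \<C> \<Longrightarrow> t < prob A \<Longrightarrow> prob D < prob A" for D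
    proof -
      have "P A D \<or> P D A" if "A \<in> \<C>" for A
      proof -
        have "prob A \<noteq> t" using none that by blast
        then have "prob A < t \<or> t < prob A" by linarith
        then show ?thesis
        proof
          assume "prob A < t"
          with lower[OF that] strictE[OF that] D show ?thesis unfolding P_def by auto
        next
          assume "t < prob A"
          with upper[OF that] strictF[OF that] D show ?thesis unfolding P_def by auto
        qed
      qed
      then have DC: "D \<in> \<C>" using D max' by blast
      then have "prob D \<noteq> t" using none by blast
      then show False using strictE[OF DC] strictF[OF DC] by linarith
    qed
    have "prob E \<noteq> t" using absurd[of E] E EF by auto
    moreover have "prob F \<noteq> t" using absurd[of F] F EF by auto
    ultimately have lt: "prob E < t" "t < prob F" using E F by auto
    have "prob (F - E) = prob F - prob E" using E F EF by (intro finite_measure_Diff) auto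
    with lt obtain G where G: "G \<in> sets M" "G \<subseteq> F - E" "0 < prob G" "prob G < prob F - prob E"
      using split[of "F - E"] E F by auto
    have D: "prob (E \<union> G) = prob E + prob G" using E G by (intro finite_measure_Union) auto
    have AE: "prob A \<le> prob E" if "A \<in> \<C>" "prob A < t" for A
      using lower[OF that] E by (intro finite_measure_mono) auto
    have FA: "prob F \<le> prob A" if "A \<in> \<C>" "t < prob A" for A
      using upper[OF that] that meas by (intro finite_measure_mono) auto
    show False
      by (rule absurd[of "E \<union> G"]) (use D E G EF AE FA in \<open>force+\<close>)
  qed
  then obtain A where A: "\<And>t. t \<in> {0..1} \<Longrightarrow> A t \<in> \<C>" "\<And>t. t \<in> {0..1} \<Longrightarrow> prob (A t) = t"
    by metis
  have "mono_on {0..1} A"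
  proof (rule mono_onI)
    fix s t :: real assume st: "s \<in> {0..1}" "t \<in> {0..1}" "s \<le> t"
    then show "A s \<subseteq> A t"
      using comp[OF A(1) A(1), of s t] A(2)[of s] A(2)[of t] by (auto simp: P_def)
  qed
  with A meas that[of A] show thesis by blast
qed

text \<open>The variable is the level at which \<open>\<omega>\<close> enters the chain. Rational levels suffice and make it
  measurable. The endpoints are removed on a null set so that quantile functions, which may be infinite
  there, can be applied at every point.\<close>

lemma atomless_obtains_uniform:
  assumes "atomless_prob_space M"
  obtains U :: "'w \<Rightarrow> real"
  where "U \<in> borel_measurable M" "\<And>\<omega>. 0 < U \<omega> \<and> U \<omega> < 1"
    "\<And>t. t \<in> {0..1} \<Longrightarrow> measure M {\<omega>\<in>space M. U \<omega> \<le> t} = t"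
proof -
  interpret prob_space M using assms by (simp add: atomless_prob_space_def)
  obtain A where A: "\<And>t. t \<in> {0..1} \<Longrightarrow> A t \<in> sets M" "\<And>t. t \<in> {0..1} \<Longrightarrow> prob (A t) = t"
    "mono_on {0..1} A"
    by (rule atomless_obtains_chain[OF assms]) blast
  define Q :: "real set" where "Q = \<rat> \<inter> {0..<1}"
  define V where "V \<omega> = Inf (insert 1 {q\<in>Q. \<omega> \<in> A q})" for \<omega>
  have bdd: "bdd_below (insert 1 {q\<in>Q. \<omega> \<in> A q})" for \<omega>
    by (auto intro!: bdd_belowI[of _ 0] simp: Q_def)
  have V_less: "V \<omega> < t \<longleftrightarrow> 1 < t \<or> (\<exists>q\<in>Q. q < t \<and> \<omega> \<in> A q)" for \<omega> t
    unfolding V_def by (subst cInf_less_iff[OF _ bdd]) auto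
  have V01: "0 \<le> V \<omega> \<and> V \<omega> \<le> 1" for \<omega>
  proof
    show "0 \<le> V \<omega>" using V_less[of \<omega> 0] by (auto simp: Q_def not_less[symmetric])
    show "V \<omega> \<le> 1" unfolding V_def by (rule cInf_lower[OF _ bdd]) auto
  qed
  have cQ: "countable Q" unfolding Q_def using countable_rat by blast
  have V[measurable]: "V \<in> borel_measurable M"
  proof (rule borel_measurableI_less)
    fix t
    have "{\<omega> \<in> space M. V \<omega> < t} = (if 1 < t then space M else (\<Union>q\<in>{q\<in>Q. q < t}. A q))"
    proof -
      have "A q \<subseteq> space M" if "q \<in> Q" for q
        using A(1)[of q] that sets.sets_into_space by (auto simp: Q_def)
      then show ?thesis by (auto simp: V_less)
    qed
    moreover have "(\<Union>q\<in>{q\<in>Q. q < t}. A q) \<in> sets M"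
    proof (rule sets.countable_UN')
      show "countable {q\<in>Q. q < t}" by (rule countable_subset[OF _ cQ]) auto
    qed (use A(1) in \<open>auto simp: Q_def\<close>)
    ultimately show "{\<omega> \<in> space M. V \<omega> < t} \<in> sets M" by auto
  qed
  have V_dist: "prob {\<omega>\<in>space M. V \<omega> \<le> t} = t" if t: "t \<in> {0..<1}" for t
  proof (rule antisym)
    show "prob {\<omega>\<in>space M. V \<omega> \<le> t} \<le> t"
    proof (rule dense_ge_bounded[of t 1])
      fix s assume s: "t < s" "s < 1"
      have "{\<omega>\<in>space M. V \<omega> \<le> t} \<subseteq> A s"
      proof safe
        fix \<omega> assume "V \<omega> \<le> t"
        with s have "V \<omega> < s" by simp
        then obtain q where "q \<in> Q" "q < s" "\<omega> \<in> A q" using s by (auto simp: V_less)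
        then show "\<omega> \<in> A s"
          using mono_onD[OF A(3), of q s] s t by (auto simp: Q_def)
      qed
      then show "prob {\<omega>\<in>space M. V \<omega> \<le> t} \<le> s"
        using A(1,2)[of s] s t finite_measure_mono[of _ "A s"] by fastforce
    qed (use t in simp)
    have "A t \<subseteq> {\<omega>\<in>space M. V \<omega> \<le> t}"
    proof
      fix \<omega> assume \<omega>: "\<omega> \<in> A t"
      have "V \<omega> \<le> t"
      proof (rule dense_ge_bounded[of t 1])
        fix s assume s: "t < s" "s < 1"
        obtain q where q: "q \<in> \<rat>" "t < q" "q < s" using Rats_dense_in_real s by blast
        then have "q \<in> Q" "\<omega> \<in> A q"
          using \<omega> mono_onD[OF A(3), of t q] s t by (auto simp: Q_def)
        then have "V \<omega> < s" using q V_less by blast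
        then show "V \<omega> \<le> s" by simp
      qed (use t in simp)
      with \<omega> A(1)[of t] t sets.sets_into_space show "\<omega> \<in> {\<omega>\<in>space M. V \<omega> \<le> t}" by fastforce
    qed
    then have "prob (A t) \<le> prob {\<omega>\<in>space M. V \<omega> \<le> t}"
      by (intro finite_measure_mono) auto
    then show "t \<le> prob {\<omega>\<in>space M. V \<omega> \<le> t}"
      using A(2)[of t] t by simp
  qed
  have AE0: "AE \<omega> in M. 0 < V \<omega>"
  proof -
    have "prob {\<omega>\<in>space M. V \<omega> \<le> 0} = 0" using V_dist[of 0] by simp
    then show ?thesis
      by (subst AE_iff_measurable[of "{\<omega>\<in>space M. V \<omega> \<le> 0}"]) (auto simp: emeasure_eq_measure)
  qed
  have AE1: "AE \<omega> in M. V \<omega> < 1"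
  proof -
    have "prob {\<omega>\<in>space M. V \<omega> < 1} \<ge> t" if "t < 1" "0 < t" for t
    proof -
      have "prob {\<omega>\<in>space M. V \<omega> \<le> t} \<le> prob {\<omega>\<in>space M. V \<omega> < 1}"
        using that by (intro finite_measure_mono) auto
      then show ?thesis using V_dist[of t] that by simp
    qed
    then have "1 \<le> prob {\<omega>\<in>space M. V \<omega> < 1}"
      by (intro dense_le_bounded[of 0 1]) auto
    then have "prob {\<omega>\<in>space M. V \<omega> < 1} = 1" by (simp add: antisym)
    then show ?thesis by (simp add: prob_Collect_eq_1)
  qed
  define U where "U \<omega> = (if 0 < V \<omega> \<and> V \<omega> < 1 then V \<omega> else 1/2)" for \<omega>
  have U[measurable]: "U \<in> borel_measurable M" unfolding U_def by measurable
  have "prob {\<omega>\<in>space M. U \<omega> \<le> t} = t" if t: "t \<in> {0..1}" for t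
  proof (cases "t = 1")
    case True
    then have "{\<omega>\<in>space M. U \<omega> \<le> t} = space M" by (auto simp: U_def)
    with True show ?thesis by (simp add: prob_space)
  next
    case False
    have "prob {\<omega>\<in>space M. U \<omega> \<le> t} = prob {\<omega>\<in>space M. V \<omega> \<le> t}"
    proof (rule finite_measure_eq_AE)
      show "AE \<omega> in M. \<omega> \<in> {\<omega>\<in>space M. U \<omega> \<le> t} \<longleftrightarrow> \<omega> \<in> {\<omega>\<in>space M. V \<omega> \<le> t}"
        using AE0 AE1 by eventually_elim (auto simp: U_def)
    qed measurable
    then show ?thesis using V_dist[of t] t False by auto
  qed
  moreover have "0 < U \<omega> \<and> U \<omega> < 1" for \<omega> by (auto simp: U_def)
  ultimately show thesis using that U by blast
qed

text \<open>This is the quantile transform: \<open>{V \<le> x}\<close> is the event that \<open>U\<close> is at most the distribution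
  function at \<open>x\<close>.\<close>

lemma atomless_real_law:
  fixes \<nu> :: "real measure"
  assumes M: "atomless_prob_space M" and "real_distribution \<nu>"
  shows "\<exists>V\<in>borel_measurable M. distr M borel V = \<nu>"
proof -
  interpret M: prob_space M using M by (simp add: atomless_prob_space_def)
  interpret cdf_distribution \<nu> using assms by (simp add: cdf_distribution_def)
  obtain U where U[measurable]: "U \<in> borel_measurable M" and U01: "\<And>\<omega>. 0 < U \<omega> \<and> U \<omega> < 1"
    and U_dist: "\<And>t. t \<in> {0..1} \<Longrightarrow> measure M {\<omega>\<in>space M. U \<omega> \<le> t} = t"
    by (rule atomless_obtains_uniform[OF M]) blast
  define V where "V \<omega> = Inf {x. U \<omega> \<le> cdf \<nu> x}" for \<omega>
  have V_le: "V \<omega> \<le> x \<longleftrightarrow> U \<omega> \<le> cdf \<nu> x" for \<omega> x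
    unfolding V_def using pseudoinverse[of "U \<omega>" x] U01[of \<omega>] by simp
  have V[measurable]: "V \<in> borel_measurable M"
    by (rule borel_measurableI_le) (simp add: V_le)
  have "distr M borel V = \<nu>"
  proof (rule cdf_unique)
    show "real_distribution (distr M borel V)"
      by (intro real_distribution.intro M.prob_space_distr real_distribution_axioms.intro) auto
    show "cdf (distr M borel V) = cdf \<nu>"
    proof
      fix x
      have "cdf (distr M borel V) x = measure M {\<omega>\<in>space M. U \<omega> \<le> cdf \<nu> x}"
        by (simp add: cdf_def measure_distr vimage_def Int_def V_le conj_commute)
      then show "cdf (distr M borel V) x = cdf \<nu> x"
        using U_dist[of "cdf \<nu> x"] cdf_nonneg cdf_bounded_prob by simp
    qed
  qed fact
  with V show ?thesis by blast
qed

text \<open>Bits are stored as digits in base 4: since the digits 2 and 3 never occur, the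
  expansion is unique and the first digit can be read off by comparison with \<open>1/4\<close>.\<close>

definition encode_bits :: "(nat \<Rightarrow> bool) \<Rightarrow> real" where
  "encode_bits b = (\<Sum>k. of_bool (b k) * (1/4) ^ Suc k)"

lemma encode_bits_summable: "summable (\<lambda>k. of_bool (b k) * (1/4::real) ^ Suc k)"
proof (rule summable_comparison_test)
  have "summable (\<lambda>k. (1/4::real) ^ k)" by (rule summable_geometric) simp
  then show "summable (\<lambda>k. (1/4::real) ^ Suc k)" using summable_Suc_iff by blast
qed auto

lemma encode_bits_bounds: "0 \<le> encode_bits b" "encode_bits b \<le> 1/3"
proof -
  have s: "(\<lambda>k. (1/4::real) ^ Suc k) sums (1/3)"
    using sums_mult[OF geometric_sums[of "1/4::real"], of "1/4"] by simp
  show "0 \<le> encode_bits b" unfolding encode_bits_def by (rule suminf_nonneg[OF encode_bits_summable]) simp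
  have "encode_bits b \<le> (\<Sum>k. (1/4::real) ^ Suc k)"
    unfolding encode_bits_def by (rule suminf_le[OF _ encode_bits_summable sums_summable[OF s]]) auto
  then show "encode_bits b \<le> 1/3" using sums_unique[OF s] by simp
qed

lemma encode_bits_shift: "4 * encode_bits b = of_bool (b 0) + encode_bits (\<lambda>k. b (Suc k))"
proof -
  have "encode_bits b = of_bool (b 0) * (1/4) + (\<Sum>k. of_bool (b (Suc k)) * (1/4) ^ Suc (Suc k))"
    unfolding encode_bits_def using suminf_split_head[OF encode_bits_summable[of b]] by simp
  also have "(\<Sum>k. of_bool (b (Suc k)) * (1/4::real) ^ Suc (Suc k)) = (1/4) * encode_bits (\<lambda>k. b (Suc k))"
    unfolding encode_bits_def using suminf_mult[OF encode_bits_summable[of "\<lambda>k. b (Suc k)"], of "1/4"]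
    by (simp add: mult_ac)
  finally show ?thesis by simp
qed

definition shift :: "real \<Rightarrow> real" where
  "shift t = 4 * t - (if 1/4 \<le> t then 1 else 0)"

definition digit :: "nat \<Rightarrow> real \<Rightarrow> bool" where
  "digit k t \<longleftrightarrow> 1/4 \<le> (shift ^^ k) t"

lemma first_digit_iff: "1/4 \<le> encode_bits b \<longleftrightarrow> b 0"
  using encode_bits_shift[of b] encode_bits_bounds[of "\<lambda>k. b (Suc k)"] by (cases "b 0") auto

lemma digit_encode_bits: "digit k (encode_bits b) = b k"
proof -
  have "shift (encode_bits b) = encode_bits (\<lambda>k. b (Suc k))" for b
    using encode_bits_shift[of b] first_digit_iff[of b] by (auto simp: shift_def)
  then have "(shift ^^ k) (encode_bits b) = encode_bits (\<lambda>i. b (i + k))"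
    by (induction k arbitrary: b) (auto simp del: funpow.simps simp: funpow_Suc_right)
  then show ?thesis
    using first_digit_iff[of "\<lambda>i. b (i + k)"] by (simp only: digit_def) simp
qed

lemma measurable_digit[measurable]: "Measurable.pred borel (digit k)"
proof -
  have [measurable]: "shift \<in> borel_measurable borel" unfolding shift_def by measurable
  have [measurable]: "(shift ^^ k) \<in> borel_measurable borel"
    by (induction k) (auto simp: comp_def)
  show ?thesis unfolding digit_def by measurable
qed

text \<open>A point is encoded by the bits telling which balls around a countable dense set contain it.
  The decoder picks, for each radius, the first ball in which the point lies; the centres of these balls
  converge to the point.\<close>

lemma obtains_borel_code:
  obtains g :: "'a::{banach, second_countable_topology} \<Rightarrow> real" and h :: "real \<Rightarrow> 'a"
  where "g \<in> borel_measurable borel" "h \<in> borel_measurable borel" "\<And>x. h (g x) = x"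
proof -
  obtain D :: "'a set" where D: "countable D" "\<And>X. open X \<Longrightarrow> X \<noteq> {} \<Longrightarrow> \<exists>d\<in>D. d \<in> X"
    using countable_dense_exists by blast
  define d where "d = from_nat_into D"
  define B where "B k x \<longleftrightarrow> dist (d (fst (prod_decode k))) x < inverse (Suc (snd (prod_decode k)))" for k x
  define g where "g x = encode_bits (\<lambda>k. B k x)" for x
  define h where "h = (\<lambda>t. lim (\<lambda>m. d (LEAST n. digit (prod_encode (n, m)) t)))"
  have g: "g \<in> borel_measurable borel"
    unfolding g_def encode_bits_def B_def by measurable
  have h: "h \<in> borel_measurable borel"
    unfolding h_def by measurable
  have "h (g x) = x" for x
  proof -
    define y where "y m = d (LEAST n. digit (prod_encode (n, m)) (g x))" for m
    have near: "dist (y m) x < inverse (Suc m)" for m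
    proof -
      have "\<exists>z\<in>D. z \<in> ball x (inverse (Suc m))" by (rule D(2)) auto
      then obtain z where z: "z \<in> D" "dist z x < inverse (Suc m)" by (auto simp: dist_commute)
      then obtain n where "d n = z" unfolding d_def using from_nat_into_surj[OF D(1)] by blast
      with z have "B (prod_encode (n, m)) x" by (simp add: B_def)
      then have "digit (prod_encode (n, m)) (g x)" by (simp add: g_def digit_encode_bits)
      then have "digit (prod_encode (LEAST n. digit (prod_encode (n, m)) (g x), m)) (g x)"
        by (rule LeastI)
      then show ?thesis by (simp add: g_def digit_encode_bits B_def y_def)
    qed
    \<comment> \<open>The ball of radius \<open>1 / (m + 1)\<close> contains the point, which bounds the error of the \<open>m\<close>-th guess.\<close>
    have "y \<longlonglongrightarrow> x"
    proof (rule metric_tendsto_imp_tendsto[OF LIMSEQ_inverse_real_of_nat])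
      show "\<forall>\<^sub>F m in sequentially. dist (y m) x \<le> dist (inverse (real (Suc m))) 0"
        using near by (auto intro!: always_eventually less_imp_le)
    qed
    then have "lim y = x" by (rule limI)
    then show ?thesis by (simp add: h_def y_def[abs_def])
  qed
  with g h that show thesis by blast
qed

text \<open>The encoding reduces the claim to laws on the real line, where the quantile transform of a uniform
  variable applies.\<close>

theorem atomless_obtains_law:
  fixes \<nu> :: "'a::{banach, second_countable_topology} measure"
  assumes M: "atomless_prob_space M" and "prob_space \<nu>" and sets: "sets \<nu> = sets borel"
  obtains Z where "Z \<in> borel_measurable M" "law M Z = \<nu>"
proof -
  obtain g :: "'a \<Rightarrow> real" and h where [measurable]: "g \<in> borel_measurable borel" "h \<in> borel_measurable borel"
    and hg: "\<And>x. h (g x) = x"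
    by (rule obtains_borel_code) blast
  have g[measurable]: "g \<in> borel_measurable \<nu>" using sets by (simp cong: measurable_cong_sets)
  interpret \<nu>: prob_space \<nu> by fact
  have "real_distribution (distr \<nu> borel g)"
    by (intro real_distribution.intro \<nu>.prob_space_distr real_distribution_axioms.intro) auto
  then obtain V where [measurable]: "V \<in> borel_measurable M" and V: "distr M borel V = distr \<nu> borel g"
    using atomless_real_law[OF M] by blast
  have "law M (\<lambda>\<omega>. h (V \<omega>)) = distr (distr M borel V) borel h"
    by (simp add: distr_distr comp_def)
  also have "\<dots> = distr \<nu> borel (\<lambda>x. x)"
    by (simp add: V distr_distr comp_def hg)
  also have "\<dots> = \<nu>"
    using sets by (intro distr_id2) simp
  finally show thesis by (intro that[of "\<lambda>\<omega>. h (V \<omega>)"]) measurable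
qed

section \<open>Square-integrable random variables and the 1-Wasserstein distance\<close>

lemma square_integrable_dominated:
  fixes X :: "'w \<Rightarrow> 'b::euclidean_space" and Y :: "'w \<Rightarrow> 'c::euclidean_space"
  assumes "square_integrable M Y" "X \<in> borel_measurable M" "\<And>\<omega>. norm (X \<omega>) \<le> norm (Y \<omega>)"
  shows "square_integrable M X"
  unfolding square_integrable_def
proof
  show "integrable M (\<lambda>\<omega>. (norm (X \<omega>))\<^sup>2)"
  proof (rule Bochner_Integration.integrable_bound)
    show "integrable M (\<lambda>\<omega>. (norm (Y \<omega>))\<^sup>2)" using assms(1) by (simp add: square_integrable_def)
    have "(norm (X \<omega>))\<^sup>2 \<le> (norm (Y \<omega>))\<^sup>2" for \<omega>
      by (rule power_mono[OF assms(3)]) simp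
    then show "AE \<omega> in M. norm ((norm (X \<omega>))\<^sup>2) \<le> norm ((norm (Y \<omega>))\<^sup>2)" by simp
  qed (use assms(2) in measurable)
qed fact

lemma square_integrable_scaleR:
  fixes X :: "'w \<Rightarrow> 'b::euclidean_space"
  assumes "square_integrable M X"
  shows "square_integrable M (\<lambda>\<omega>. c *\<^sub>R X \<omega>)"
  using assms by (auto simp: square_integrable_def power_mult_distrib)

lemma square_integrable_norm:
  fixes X :: "'w \<Rightarrow> 'b::euclidean_space"
  assumes "square_integrable M X"
  shows "square_integrable M (\<lambda>\<omega>. norm (X \<omega>))"
  using assms by (auto simp: square_integrable_def)

lemma square_integrable_add:
  fixes X Y :: "'w \<Rightarrow> 'b::euclidean_space"
  assumes "square_integrable M X" "square_integrable M Y"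
  shows "square_integrable M (\<lambda>\<omega>. X \<omega> + Y \<omega>)"
  unfolding square_integrable_def
proof
  have [measurable]: "X \<in> borel_measurable M" "Y \<in> borel_measurable M"
    using assms by (auto simp: square_integrable_def)
  show "(\<lambda>\<omega>. X \<omega> + Y \<omega>) \<in> borel_measurable M" by measurable
  show "integrable M (\<lambda>\<omega>. (norm (X \<omega> + Y \<omega>))\<^sup>2)"
  proof (rule Bochner_Integration.integrable_bound)
    show "integrable M (\<lambda>\<omega>. 2 * (norm (X \<omega>))\<^sup>2 + 2 * (norm (Y \<omega>))\<^sup>2)"
      using assms by (auto simp: square_integrable_def)
    have "(norm (x + y))\<^sup>2 \<le> 2 * (norm x)\<^sup>2 + 2 * (norm y)\<^sup>2" for x y :: 'b
    proof -
      have "(norm (x + y))\<^sup>2 \<le> (norm x + norm y)\<^sup>2"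
        by (intro power_mono norm_triangle_ineq) simp
      also have "\<dots> \<le> 2 * (norm x)\<^sup>2 + 2 * (norm y)\<^sup>2"
        using sum_squares_bound[of "norm x" "norm y"] by (simp add: power2_sum)
      finally show ?thesis .
    qed
    then show "AE \<omega> in M. norm ((norm (X \<omega> + Y \<omega>))\<^sup>2) \<le> norm (2 * (norm (X \<omega>))\<^sup>2 + 2 * (norm (Y \<omega>))\<^sup>2)"
      by simp
  qed measurable
qed

lemma square_integrable_diff:
  fixes X Y :: "'w \<Rightarrow> 'b::euclidean_space"
  assumes "square_integrable M X" "square_integrable M Y"
  shows "square_integrable M (\<lambda>\<omega>. X \<omega> - Y \<omega>)"
  using square_integrable_add[OF assms(1) square_integrable_scaleR[OF assms(2), of "-1"]] by simp

lemma (in finite_measure) square_integrable_const: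
  "square_integrable M (\<lambda>\<omega>. c :: 'b::euclidean_space)"
  by (simp add: square_integrable_def)

lemma (in finite_measure) square_integrable_imp_integrable:
  fixes X :: "'a \<Rightarrow> 'b::euclidean_space"
  assumes "square_integrable M X"
  shows "integrable M X"
proof (rule Bochner_Integration.integrable_bound)
  show "integrable M (\<lambda>\<omega>. 1 + (norm (X \<omega>))\<^sup>2)"
    using assms by (auto simp: square_integrable_def)
  have "r \<le> 1 + r\<^sup>2" for r :: real
    using sum_squares_bound[of r 1] by (simp add: add_increasing power2_eq_square) (smt (verit) zero_le_square)
  then show "AE \<omega> in M. norm (X \<omega>) \<le> norm (1 + (norm (X \<omega>))\<^sup>2)" by auto
qed (use assms in \<open>auto simp: square_integrable_def\<close>)

lemma square_integrable_Pair:
  fixes X :: "'w \<Rightarrow> 'b::euclidean_space" and Y :: "'w \<Rightarrow> 'c::euclidean_space"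
  shows "square_integrable M (\<lambda>\<omega>. (X \<omega>, Y \<omega>)) \<longleftrightarrow> square_integrable M X \<and> square_integrable M Y"
proof safe
  assume XY: "square_integrable M (\<lambda>\<omega>. (X \<omega>, Y \<omega>))"
  then have "(\<lambda>\<omega>. (X \<omega>, Y \<omega>)) \<in> M \<rightarrow>\<^sub>M borel \<Otimes>\<^sub>M borel"
    by (simp add: square_integrable_def borel_prod)
  then have "X \<in> borel_measurable M" "Y \<in> borel_measurable M"
    by (auto dest: measurable_fst'' measurable_snd'')
  then show "square_integrable M X" "square_integrable M Y"
    by - (rule square_integrable_dominated[OF XY], simp_all add: norm_fst_le norm_snd_le)+
next
  assume XY: "square_integrable M X" "square_integrable M Y"
  then have "X \<in> borel_measurable M" "Y \<in> borel_measurable M"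
    by (simp_all add: square_integrable_def)
  then have "(\<lambda>\<omega>. (X \<omega>, Y \<omega>)) \<in> borel_measurable M"
    by (rule borel_measurable_Pair)
  moreover have "norm (X \<omega>, Y \<omega>) \<le> norm (norm (X \<omega>) + norm (Y \<omega>))" for \<omega>
    using norm_Pair_le[of "X \<omega>" "Y \<omega>"] by simp
  ultimately show "square_integrable M (\<lambda>\<omega>. (X \<omega>, Y \<omega>))"
    by (rule square_integrable_dominated[OF square_integrable_add[OF XY[THEN square_integrable_norm]]])
qed

lemma law_in_P2_iff:
  fixes Z :: "'w \<Rightarrow> 'b::euclidean_space"
  assumes "prob_space M" "Z \<in> borel_measurable M"
  shows "law M Z \<in> P2 \<longleftrightarrow> square_integrable M Z"
  using assms by (auto simp: P2_def square_integrable_def integrable_distr_eq prob_space.prob_space_distr)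

lemma borel_measurable_projections [measurable]:
  "fst \<in> borel_measurable (borel :: ('b::topological_space \<times> 'c::topological_space) measure)"
  "snd \<in> borel_measurable (borel :: ('b::topological_space \<times> 'c::topological_space) measure)"
  by (auto intro!: borel_measurable_continuous_onI continuous_intros)

lemma law_Pair_in_couplings:
  fixes X Y :: "'w \<Rightarrow> 'b::second_countable_topology"
  assumes [measurable]: "X \<in> borel_measurable M" "Y \<in> borel_measurable M"
  shows "law M (\<lambda>\<omega>. (X \<omega>, Y \<omega>)) \<in> couplings (law M X) (law M Y)"
proof -
  have "sets (law M X \<Otimes>\<^sub>M law M Y) = sets (borel \<Otimes>\<^sub>M borel :: ('b \<times> 'b) measure)"
    by (intro sets_pair_measure_cong) auto
  then have "sets (law M (\<lambda>\<omega>. (X \<omega>, Y \<omega>))) = sets (law M X \<Otimes>\<^sub>M law M Y)"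
    unfolding borel_prod by simp
  moreover have "distr (law M (\<lambda>\<omega>. (X \<omega>, Y \<omega>))) (law M X) fst = law M X"
  proof -
    have "distr (law M (\<lambda>\<omega>. (X \<omega>, Y \<omega>))) (law M X) fst = distr (law M (\<lambda>\<omega>. (X \<omega>, Y \<omega>))) borel fst"
      by (rule distr_cong) auto
    then show ?thesis by (simp add: distr_distr comp_def)
  qed
  moreover have "distr (law M (\<lambda>\<omega>. (X \<omega>, Y \<omega>))) (law M Y) snd = law M Y"
  proof -
    have "distr (law M (\<lambda>\<omega>. (X \<omega>, Y \<omega>))) (law M Y) snd = distr (law M (\<lambda>\<omega>. (X \<omega>, Y \<omega>))) borel snd"
      by (rule distr_cong) auto
    then show ?thesis by (simp add: distr_distr comp_def)
  qed
  ultimately show ?thesis by (simp add: couplings_def)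
qed

lemma transport_cost_law_Pair:
  fixes X Y :: "'w \<Rightarrow> 'b::euclidean_space"
  assumes [measurable]: "X \<in> borel_measurable M" "Y \<in> borel_measurable M"
    and "integrable M (\<lambda>\<omega>. dist (X \<omega>) (Y \<omega>))"
  shows "(\<integral>\<^sup>+ z. ennreal (dist (fst z) (snd z) powr 1) \<partial>law M (\<lambda>\<omega>. (X \<omega>, Y \<omega>)))
    = ennreal (LINT \<omega>|M. dist (X \<omega>) (Y \<omega>))"
proof -
  have "(\<integral>\<^sup>+ z. ennreal (dist (fst z) (snd z) powr 1) \<partial>law M (\<lambda>\<omega>. (X \<omega>, Y \<omega>)))
    = (\<integral>\<^sup>+ \<omega>. ennreal (dist (X \<omega>) (Y \<omega>)) \<partial>M)"
    by (subst nn_integral_distr) (simp_all flip: borel_prod)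
  also have "\<dots> = ennreal (LINT \<omega>|M. dist (X \<omega>) (Y \<omega>))"
    using assms by (intro nn_integral_eq_integral) auto
  finally show ?thesis .
qed

text \<open>The joint law of \<open>X\<close> and \<open>Y\<close> is a coupling, and the mean distance is its cost.\<close>

lemma wasserstein_1_law_le:
  fixes X Y :: "'w \<Rightarrow> 'b::euclidean_space"
  assumes "X \<in> borel_measurable M" "Y \<in> borel_measurable M"
    and "integrable M (\<lambda>\<omega>. dist (X \<omega>) (Y \<omega>))"
  shows "wasserstein 1 (law M X) (law M Y) \<le> (LINT \<omega>|M. dist (X \<omega>) (Y \<omega>))"
proof -
  have "(INF \<pi>\<in>couplings (law M X) (law M Y). \<integral>\<^sup>+ z. ennreal (dist (fst z) (snd z) powr 1) \<partial>\<pi>)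
      \<le> ennreal (LINT \<omega>|M. dist (X \<omega>) (Y \<omega>))"
    using law_Pair_in_couplings[OF assms(1,2)] transport_cost_law_Pair[OF assms]
    by (metis (no_types, lifting) INF_lower)
  then show ?thesis
    unfolding wasserstein_def by (auto intro!: enn2real_leI)
qed

text \<open>Conversely, on an atomless space every coupling is the joint law of a pair of random variables, so a
  bound that holds for all such pairs holds for the infimum. The infimum must also be seen to be finite,
  for otherwise its real value would be 0.\<close>

lemma le_wasserstein_1:
  fixes \<mu> \<nu> :: "'b::euclidean_space measure"
  assumes M: "atomless_prob_space M" and P2: "\<mu> \<in> P2" "\<nu> \<in> P2"
    and le: "\<And>X Y. square_integrable M X \<Longrightarrow> square_integrable M Y \<Longrightarrow> law M X = \<mu> \<Longrightarrow> law M Y = \<nu>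
      \<Longrightarrow> c \<le> (LINT \<omega>|M. dist (X \<omega>) (Y \<omega>))"
  shows "c \<le> wasserstein 1 \<mu> \<nu>"
proof -
  interpret prob_space M using M by (simp add: atomless_prob_space_def)
  let ?cost = "\<lambda>\<pi>. \<integral>\<^sup>+ z. ennreal (dist (fst z) (snd z) powr 1) \<partial>\<pi>"
  let ?W = "INF \<pi>\<in>couplings \<mu> \<nu>. ?cost \<pi>"
  have dist_int: "integrable M (\<lambda>\<omega>. dist (X \<omega>) (Y \<omega>))"
    if "square_integrable M X" "square_integrable M Y" for X Y :: "_ \<Rightarrow> 'b"
    unfolding dist_norm
    by (intro square_integrable_imp_integrable square_integrable_norm square_integrable_diff that)
  have sq: "square_integrable M X" if "X \<in> borel_measurable M" "law M X \<in> P2" for X :: "_ \<Rightarrow> 'b"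
    using that law_in_P2_iff[OF prob_space_axioms] by blast
  have sets: "sets \<mu> = sets borel" "sets \<nu> = sets borel" and prob: "prob_space \<mu>" "prob_space \<nu>"
    using P2 by (auto simp: P2_def)
  have "ennreal c \<le> ?cost \<pi>" if \<pi>: "\<pi> \<in> couplings \<mu> \<nu>" for \<pi>
  proof -
    have "sets (\<mu> \<Otimes>\<^sub>M \<nu>) = sets (borel \<Otimes>\<^sub>M borel :: ('b \<times> 'b) measure)"
      using sets by (rule sets_pair_measure_cong)
    then have s\<pi>: "sets \<pi> = sets borel" using \<pi> unfolding couplings_def borel_prod by simp
    have [measurable]: "fst \<in> borel_measurable \<pi>" "snd \<in> borel_measurable \<pi>"
      using s\<pi> by (simp_all cong: measurable_cong_sets)
    have "distr \<pi> \<mu> fst = law \<pi> fst" "distr \<pi> \<nu> snd = law \<pi> snd"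
      using sets by (auto intro!: distr_cong)
    then have marg: "law \<pi> fst = \<mu>" "law \<pi> snd = \<nu>" using \<pi> by (auto simp: couplings_def)
    have "prob_space \<pi>"
      by (rule prob_space_distrD[of fst \<pi> borel]) (use marg prob in simp_all)
    then obtain Z where [measurable]: "Z \<in> borel_measurable M" and Z: "law M Z = \<pi>"
      using atomless_obtains_law[OF M _ s\<pi>] by blast
    have law: "law M (\<lambda>\<omega>. fst (Z \<omega>)) = \<mu>" "law M (\<lambda>\<omega>. snd (Z \<omega>)) = \<nu>"
      using marg by (simp_all add: distr_distr comp_def flip: Z)
    then have sqZ: "square_integrable M (\<lambda>\<omega>. fst (Z \<omega>))" "square_integrable M (\<lambda>\<omega>. snd (Z \<omega>))"
      using P2 by (auto intro!: sq)
    have "ennreal c \<le> ennreal (LINT \<omega>|M. dist (fst (Z \<omega>)) (snd (Z \<omega>)))"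
      using le[OF sqZ law] by (rule ennreal_leI)
    also have "\<dots> = ?cost \<pi>"
      using transport_cost_law_Pair[OF _ _ dist_int[OF sqZ]] Z by simp
    finally show ?thesis .
  qed
  then have "ennreal c \<le> ?W" by (rule INF_greatest)
  moreover have "?W < top"
  proof -
    obtain X Y where XY: "X \<in> borel_measurable M" "law M X = \<mu>" "Y \<in> borel_measurable M" "law M Y = \<nu>"
      using atomless_obtains_law[OF M prob(1) sets(1)] atomless_obtains_law[OF M prob(2) sets(2)] by metis
    then have "square_integrable M X" "square_integrable M Y" using P2 by (auto intro!: sq)
    then have "?cost (law M (\<lambda>\<omega>. (X \<omega>, Y \<omega>))) < top"
      using transport_cost_law_Pair[OF XY(1,3) dist_int] by simp
    moreover have "?W \<le> ?cost (law M (\<lambda>\<omega>. (X \<omega>, Y \<omega>)))"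
      using law_Pair_in_couplings[OF XY(1,3)] XY by (intro INF_lower) simp
    ultimately show ?thesis by (rule le_less_trans[rotated])
  qed
  ultimately have "c \<le> enn2real ?W"
    using enn2real_mono[of "ennreal c" ?W] by (cases "0 \<le> c") (auto intro: order_trans[of c 0])
  then show ?thesis by (simp add: wasserstein_def)
qed

lemma wasserstein_1_self:
  fixes \<rho> :: "'b::euclidean_space measure"
  assumes "\<rho> \<in> P2"
  shows "wasserstein 1 \<rho> \<rho> = 0"
proof -
  have \<rho>: "sets \<rho> = sets borel" using assms by (auto simp: P2_def)
  have [measurable]: "(\<lambda>x. x) \<in> borel_measurable \<rho>" using \<rho> by (simp cong: measurable_cong_sets)
  have "law \<rho> (\<lambda>x. x) = \<rho>" using \<rho> by (intro distr_id2) simp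
  then have "wasserstein 1 \<rho> \<rho> \<le> 0"
    using wasserstein_1_law_le[of "\<lambda>x. x" \<rho> "\<lambda>x. x"] by simp
  then show ?thesis by (simp add: wasserstein_def antisym)
qed

section \<open>Strong convexity and the conjugate function\<close>

lemma grad_eqI:
  assumes "GDERIV f x :> D"
  shows "grad f x = D"
  unfolding grad_def
proof (rule the_equality)
  fix D' assume "GDERIV f x :> D'"
  with assms have "(\<lambda>h. h \<bullet> D) = (\<lambda>h. h \<bullet> D')"
    unfolding gderiv_def by (rule has_derivative_unique)
  then have "\<And>h. h \<bullet> D = h \<bullet> D'" by (rule fun_cong)
  then show "D' = D" using vector_eq_ldot by metis
qed fact

text \<open>In finite dimension every linear functional is represented by a vector, so differentiability
  yields a gradient.\<close>

lemma differentiable_imp_GDERIV_grad: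
  fixes f :: "'a::euclidean_space \<Rightarrow> real"
  assumes "f differentiable (at x)"
  shows "GDERIV f x :> grad f x"
proof -
  from assms obtain f' where f': "(f has_derivative f') (at x)" by (auto simp: differentiable_def)
  then have "linear f'" by (rule has_derivative_linear)
  then have "f' = (\<lambda>h. h \<bullet> adjoint f' 1)"
    using adjoint_works[of f' _ 1] by (auto simp: inner_commute)
  then have "GDERIV f x :> adjoint f' 1"
    using f' unfolding gderiv_def by simp
  then show ?thesis using grad_eqI by metis
qed

definition strongly_convex_grad :: "real \<Rightarrow> ('a::euclidean_space \<Rightarrow> real) \<Rightarrow> bool" where
  "strongly_convex_grad c f \<longleftrightarrow> 0 < c \<and> (\<forall>a. f differentiable (at a)) \<and>
     (\<forall>a b. c / 2 * (norm (b - a))\<^sup>2 \<le> f b - f a - grad f a \<bullet> (b - a))"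

text \<open>The point \<open>a\<close> is the minimiser of \<open>p \<bullet> a + f a\<close>. This function is coercive, because it
  exceeds its linearisation at 0 by a quadratic, so it has a minimum, where its gradient vanishes.\<close>

lemma strongly_convex_grad_surj:
  fixes f :: "'a::euclidean_space \<Rightarrow> real"
  assumes f: "strongly_convex_grad c f"
  obtains a where "p + grad f a = 0"
proof -
  define g where "g a = p \<bullet> a + f a" for a
  have g: "GDERIV g a :> p + grad f a" for a
  proof -
    have "GDERIV f a :> grad f a"
      using f by (intro differentiable_imp_GDERIV_grad) (auto simp: strongly_convex_grad_def)
    moreover have "((\<lambda>a. p \<bullet> a) has_derivative (\<lambda>h. p \<bullet> h)) (at a)"
      by (auto intro!: derivative_eq_intros)
    ultimately show ?thesis
      unfolding g_def gderiv_def by (auto intro!: derivative_eq_intros simp: inner_commute inner_add_right)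
  qed
  then have cont: "continuous_on A g" for A
    by (intro continuous_at_imp_continuous_on ballI has_derivative_continuous) (auto simp: gderiv_def)
  define v where "v = p + grad f 0"
  \<comment> \<open>Outside the ball of radius \<open>r\<close> the quadratic term dominates the linear term \<open>v \<bullet> a\<close>.\<close>
  define r where "r = 2 * norm v / c"
  have c: "0 < c" using f by (simp add: strongly_convex_grad_def)
  have far: "g 0 \<le> g a" if "r \<le> norm a" for a
  proof -
    have "c / 2 * (norm a)\<^sup>2 \<le> f a - f 0 - grad f 0 \<bullet> a"
      using f unfolding strongly_convex_grad_def by (metis diff_zero)
    moreover have "- (norm v * norm a) \<le> v \<bullet> a"
      using Cauchy_Schwarz_ineq2[of v a] by linarith
    moreover have "norm v * norm a \<le> c / 2 * (norm a)\<^sup>2"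
    proof -
      have "norm v \<le> c / 2 * norm a" using that c by (simp add: r_def field_simps)
      then show ?thesis
        using mult_right_mono[of "norm v" "c / 2 * norm a" "norm a"] by (simp add: power2_eq_square mult.assoc)
    qed
    ultimately show ?thesis by (simp add: g_def v_def inner_add_left)
  qed
  have r: "0 \<le> r" using c by (simp add: r_def)
  then obtain a where a: "a \<in> cball 0 r" "\<And>b. b \<in> cball 0 r \<Longrightarrow> g a \<le> g b"
    using continuous_attains_inf[of "cball (0::'a) r" g] cont by (metis centre_in_cball compact_cball empty_iff)
  have "g a \<le> g b" for b
    using a(2)[of b] a(2)[of 0] far[of b] r by (cases "norm b \<le> r") auto
  then have "(\<lambda>h. h \<bullet> (p + grad f a)) = (\<lambda>h. 0)"
    using g[of a] by (intro differential_zero_maxmin[of a UNIV g]) (auto simp: gderiv_def)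
  then have "(p + grad f a) \<bullet> (p + grad f a) = 0" by (rule fun_cong)
  then show thesis using that by simp
qed

text \<open>Add the convexity inequality at \<open>a\<close> to the one at \<open>b\<close>, which gives strong monotonicity of the
  gradient, and apply the Cauchy-Schwarz inequality.\<close>

lemma strongly_convex_grad_monotone:
  assumes f: "strongly_convex_grad c f"
  shows "c * norm (a - b) \<le> norm (grad f a - grad f b)"
proof -
  have "c / 2 * (norm (a - b))\<^sup>2 \<le> f b - f a - grad f a \<bullet> (b - a)"
    "c / 2 * (norm (a - b))\<^sup>2 \<le> f a - f b - grad f b \<bullet> (a - b)"
    using f unfolding strongly_convex_grad_def by (metis norm_minus_commute)+
  then have "c * (norm (a - b))\<^sup>2 \<le> (grad f a - grad f b) \<bullet> (a - b)"
    by (simp add: inner_diff_left inner_diff_right)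
  also have "\<dots> \<le> norm (grad f a - grad f b) * norm (a - b)"
    by (rule norm_cauchy_schwarz)
  finally have "(c * norm (a - b)) * norm (a - b) \<le> norm (grad f a - grad f b) * norm (a - b)"
    by (simp add: power2_eq_square mult.assoc)
  then show ?thesis by (cases "a = b") (auto simp: mult_right_le_imp_le)
qed

text \<open>In terms of the usual convex conjugate \<open>f\<^sup>*\<close>, this concave function is \<open>- f\<^sup>* (- p)\<close>. For the
  Lagrangian as a function of the control it is the Hamiltonian as a function of the momentum.\<close>

definition legendre :: "('a::euclidean_space \<Rightarrow> real) \<Rightarrow> 'a \<Rightarrow> real" where
  "legendre f p = (INF a. p \<bullet> a + f a)"

lemma legendre_eq:
  assumes f: "strongly_convex_grad c f" and a: "p + grad f a = 0"
  shows "legendre f p = p \<bullet> a + f a" and "p \<bullet> a + f a \<le> p \<bullet> b + f b"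
proof -
  have *: "p \<bullet> a + f a \<le> p \<bullet> b + f b" for b
  proof -
    have "0 \<le> c / 2 * (norm (b - a))\<^sup>2" "c / 2 * (norm (b - a))\<^sup>2 \<le> f b - f a - grad f a \<bullet> (b - a)"
      using f by (auto simp: strongly_convex_grad_def)
    moreover have "grad f a = - p" using a by (simp add: eq_neg_iff_add_eq_0 add.commute)
    ultimately show ?thesis by (simp add: inner_diff_right)
  qed
  show "legendre f p = p \<bullet> a + f a"
    unfolding legendre_def
    by (rule cInf_eq_minimum) (use * in auto)
  show "p \<bullet> a + f a \<le> p \<bullet> b + f b" by fact
qed

text \<open>This is the envelope theorem. Testing the infimum at \<open>p\<close> with the minimiser \<open>b\<close> for \<open>q\<close>, and
  the one at \<open>q\<close> with the minimiser \<open>a\<close> for \<open>p\<close>, squeezes the remainder between \<open>(q - p) \<bullet> (b - a)\<close>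
  and 0; and \<open>b - a\<close> is at most of order \<open>q - p\<close> since the gradient is strongly monotone.\<close>

lemma legendre_GDERIV:
  assumes f: "strongly_convex_grad c f" and a: "p + grad f a = 0"
  shows "GDERIV (legendre f) p :> a"
  unfolding gderiv_def has_derivative_at_alt
proof (intro conjI allI impI)
  show "bounded_linear (\<lambda>h. h \<bullet> a)" by (rule bounded_linear_inner_left)
  have c: "0 < c" using f by (simp add: strongly_convex_grad_def)
  fix e :: real assume e: "0 < e"
  show "\<exists>d>0. \<forall>q. norm (q - p) < d \<longrightarrow> norm (legendre f q - legendre f p - (q - p) \<bullet> a) \<le> e * norm (q - p)"
  proof (intro exI[of _ "c * e"] conjI allI impI)
    show "0 < c * e" using c e by simp
    fix q assume q: "norm (q - p) < c * e"
    obtain b where b: "q + grad f b = 0" by (rule strongly_convex_grad_surj[OF f])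
    have "grad f b - grad f a = p - q"
      using a b by (metis add.commute add_eq_0_iff diff_minus_eq_add minus_diff_eq uminus_add_conv_diff)
    then have "c * norm (b - a) \<le> norm (q - p)"
      using strongly_convex_grad_monotone[OF f, of b a] by (simp add: norm_minus_commute)
    with q have "c * norm (b - a) < c * e" by simp
    then have ba: "norm (b - a) \<le> e" using c by simp
    have H: "legendre f q = q \<bullet> b + f b" "legendre f p = p \<bullet> a + f a"
      "q \<bullet> b + f b \<le> q \<bullet> a + f a" "p \<bullet> a + f a \<le> p \<bullet> b + f b"
      using legendre_eq[OF f a] legendre_eq[OF f b] by auto
    have "\<bar>(q - p) \<bullet> (b - a)\<bar> \<le> norm (q - p) * norm (b - a)"
      by (rule Cauchy_Schwarz_ineq2)
    also have "\<dots> \<le> norm (q - p) * e" using ba by (intro mult_left_mono) auto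
    finally have "\<bar>(q - p) \<bullet> (b - a)\<bar> \<le> e * norm (q - p)" by (simp add: mult.commute)
    moreover have "legendre f q - legendre f p - (q - p) \<bullet> a \<le> 0"
      "(q - p) \<bullet> (b - a) \<le> legendre f q - legendre f p - (q - p) \<bullet> a"
      using H by (auto simp: inner_diff_left inner_diff_right)
    ultimately show "norm (legendre f q - legendre f p - (q - p) \<bullet> a) \<le> e * norm (q - p)"
      by (simp add: abs_le_iff)
  qed
qed

lemma legendre_grad_equation:
  assumes f: "strongly_convex_grad c f"
  shows "legendre f differentiable (at p)" and "p + grad f (grad (legendre f) p) = 0"
proof -
  obtain a where a: "p + grad f a = 0" by (rule strongly_convex_grad_surj[OF f])
  note d = legendre_GDERIV[OF f a]
  show "legendre f differentiable (at p)" using d by (auto simp: gderiv_def differentiable_def)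
  show "p + grad f (grad (legendre f) p) = 0" using a grad_eqI[OF d] by simp
qed

text \<open>The two gradients solve \<open>p + grad f a = 0\<close> and \<open>q + grad g b = 0\<close>. Subtracting the equations and
  comparing \<open>f\<close> and \<open>g\<close> at the same point \<open>b\<close> leaves a difference of gradients of \<open>f\<close> alone, to which
  monotonicity applies. The factor in front of the perturbation is exactly 1, and the comparison of the
  constants in the contraction depends on that.\<close>

lemma legendre_grad_stability:
  assumes f: "strongly_convex_grad c f" and g: "strongly_convex_grad c' g"
  shows "c * norm (grad (legendre f) p - grad (legendre g) q)
    \<le> norm (p - q) + norm (grad f (grad (legendre g) q) - grad g (grad (legendre g) q))"
proof -
  define a b where "a = grad (legendre f) p" and "b = grad (legendre g) q"
  have "grad f a = - p" "grad g b = - q"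
    using legendre_grad_equation(2)[OF f, of p] legendre_grad_equation(2)[OF g, of q]
    by (auto simp: a_def b_def eq_neg_iff_add_eq_0 add.commute)
  then have "grad f a - grad f b = - ((p - q) + (grad f b - grad g b))" by simp
  then have "norm (grad f a - grad f b) \<le> norm (p - q) + norm (grad f b - grad g b)"
    by (metis norm_minus_cancel norm_triangle_ineq)
  with strongly_convex_grad_monotone[OF f, of a b] show ?thesis by (simp add: a_def b_def)
qed

section \<open>Maps that contract the supremum norm by the mean norm\<close>

text \<open>The bound controls the difference of two images at every point by a mean distance. The Picard iterates
  therefore converge uniformly, and the limit differs from a square-integrable iterate by a bounded
  function. This replaces the completeness of a space of equivalence classes, and produces a fixed point
  that satisfies the equation everywhere and not only almost everywhere.\<close>

lemma (in prob_space) uniform_contraction_fixed_point: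
  fixes T :: "('a \<Rightarrow> 'b::euclidean_space) \<Rightarrow> 'a \<Rightarrow> 'b"
  assumes T: "\<And>\<alpha>. square_integrable M \<alpha> \<Longrightarrow> square_integrable M (T \<alpha>)"
    and contr: "\<And>\<alpha> \<beta> \<omega>. square_integrable M \<alpha> \<Longrightarrow> square_integrable M \<beta> \<Longrightarrow>
      norm (T \<alpha> \<omega> - T \<beta> \<omega>) \<le> k * (LINT \<omega>|M. norm (\<alpha> \<omega> - \<beta> \<omega>))"
    and k: "0 \<le> k" "k < 1"
  obtains \<alpha> where "square_integrable M \<alpha>" "T \<alpha> = \<alpha>"
proof -
  have int: "integrable M (\<lambda>\<omega>. norm (\<alpha> \<omega> - \<beta> \<omega>))"
    if "square_integrable M \<alpha>" "square_integrable M \<beta>" for \<alpha> \<beta> :: "'a \<Rightarrow> 'b"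
    by (intro square_integrable_imp_integrable square_integrable_norm square_integrable_diff that)
  have int_le: "(LINT \<omega>|M. norm (\<alpha> \<omega> - \<beta> \<omega>)) \<le> e"
    if "square_integrable M \<alpha>" "square_integrable M \<beta>" "\<And>\<omega>. norm (\<alpha> \<omega> - \<beta> \<omega>) \<le> e"
    for \<alpha> \<beta> :: "'a \<Rightarrow> 'b" and e
    using integral_le_const[OF int[OF that(1,2)]] that(3) by simp
  define \<alpha> where "\<alpha> n = (T ^^ n) (T (\<lambda>_. 0))" for n
  have sq: "square_integrable M (\<alpha> n)" for n
    by (induction n) (auto simp: \<alpha>_def intro!: T square_integrable_const)
  have Suc: "\<alpha> (Suc n) = T (\<alpha> n)" for n by (simp add: \<alpha>_def)
  \<comment> \<open>The pointwise bound is available only after one application of \<open>T\<close>, so the estimates start with the second increment.\<close>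
  define E where "E = k * (LINT \<omega>|M. norm (\<alpha> 1 \<omega> - \<alpha> 0 \<omega>))"
  have step: "norm (\<alpha> (Suc (Suc n)) \<omega> - \<alpha> (Suc n) \<omega>) \<le> k ^ n * E" for n \<omega>
  proof (induction n arbitrary: \<omega>)
    case 0
    then show ?case using contr[OF sq[of 1] sq[of 0], of \<omega>] by (simp add: E_def Suc)
  next
    case (Suc n)
    have "norm (\<alpha> (Suc (Suc (Suc n))) \<omega> - \<alpha> (Suc (Suc n)) \<omega>)
      \<le> k * (LINT \<omega>|M. norm (\<alpha> (Suc (Suc n)) \<omega> - \<alpha> (Suc n) \<omega>))"
      using contr[OF sq[of "Suc (Suc n)"] sq[of "Suc n"], of \<omega>] by (simp only: \<open>\<And>n. \<alpha> (Suc n) = T (\<alpha> n)\<close>)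
    also have "\<dots> \<le> k * (k ^ n * E)"
      using k Suc.IH by (intro mult_left_mono int_le sq) auto
    finally show ?case by simp
  qed
  have "uniform_limit UNIV (\<lambda>n \<omega>. \<Sum>i<n. \<alpha> (Suc (Suc i)) \<omega> - \<alpha> (Suc i) \<omega>)
      (\<lambda>\<omega>. \<Sum>i. \<alpha> (Suc (Suc i)) \<omega> - \<alpha> (Suc i) \<omega>) sequentially"
    using step k by (intro Weierstrass_m_test[where M="\<lambda>n. k ^ n * E"] summable_mult2 summable_geometric) auto
  then have "uniform_limit UNIV (\<lambda>n \<omega>. \<alpha> (Suc n) \<omega> - \<alpha> 1 \<omega>)
      (\<lambda>\<omega>. \<Sum>i. \<alpha> (Suc (Suc i)) \<omega> - \<alpha> (Suc i) \<omega>) sequentially"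
    using sum_lessThan_telescope[of "\<lambda>i. \<alpha> (Suc i) _"] by simp
  then obtain l where l: "uniform_limit UNIV (\<lambda>n \<omega>. \<alpha> (Suc n) \<omega> - \<alpha> 1 \<omega>) l sequentially" by blast
  define \<beta> where "\<beta> \<omega> = l \<omega> + \<alpha> 1 \<omega>" for \<omega>
  have near: "\<exists>n. \<forall>\<omega>. norm (\<alpha> (Suc n) \<omega> - \<beta> \<omega>) < e \<and> norm (\<alpha> (Suc (Suc n)) \<omega> - \<beta> \<omega>) < e" if e: "0 < e" for e
  proof -
    obtain N where "\<And>n \<omega>. N \<le> n \<Longrightarrow> norm (\<alpha> (Suc n) \<omega> - \<beta> \<omega>) < e"
      using uniform_limitD[OF l e] by (auto simp: eventually_sequentially dist_norm \<beta>_def algebra_simps)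
    then show ?thesis by (intro exI[of _ N]) simp
  qed
  have [measurable]: "\<alpha> n \<in> borel_measurable M" for n using sq[of n] by (simp add: square_integrable_def)
  have "l \<in> borel_measurable M"
  proof (rule borel_measurable_LIMSEQ_metric)
    show "(\<lambda>n. \<alpha> (Suc n) \<omega> - \<alpha> 1 \<omega>) \<longlonglongrightarrow> l \<omega>" for \<omega>
      by (rule tendsto_uniform_limitI[OF l UNIV_I])
  qed measurable
  then have [measurable]: "\<beta> \<in> borel_measurable M" unfolding \<beta>_def by measurable
  have sq\<beta>: "square_integrable M \<beta>"
  proof -
    obtain n where n: "\<And>\<omega>. norm (\<alpha> n \<omega> - \<beta> \<omega>) < 1" using near[of 1] by auto
    have "square_integrable M (\<lambda>\<omega>. \<alpha> n \<omega> - \<beta> \<omega>)"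
      by (rule square_integrable_dominated[OF square_integrable_const[of "1::real"]]) (use n less_imp_le in auto)
    from square_integrable_diff[OF sq[of n] this] show ?thesis by simp
  qed
  have "T \<beta> \<omega> = \<beta> \<omega>" for \<omega>
  proof -
    have "norm (T \<beta> \<omega> - \<beta> \<omega>) \<le> 0 + e" if e: "0 < e" for e
    proof -
      obtain n where n: "\<And>\<omega>. norm (\<alpha> n \<omega> - \<beta> \<omega>) < e / 2" "\<And>\<omega>. norm (\<alpha> (Suc n) \<omega> - \<beta> \<omega>) < e / 2"
        using near[of "e / 2"] e by auto
      have "norm (T \<beta> \<omega> - \<alpha> (Suc n) \<omega>) \<le> k * (LINT \<omega>|M. norm (\<beta> \<omega> - \<alpha> n \<omega>))"
        unfolding Suc by (rule contr[OF sq\<beta> sq])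
      also have "\<dots> \<le> 1 * (e / 2)"
        using k e n(1) by (intro mult_mono int_le sq sq\<beta>) (auto simp: norm_minus_commute less_imp_le)
      finally have "norm (T \<beta> \<omega> - \<alpha> (Suc n) \<omega>) \<le> e / 2" by simp
      then show ?thesis using n(2)[of \<omega>] norm_diff_triangle_le[of "T \<beta> \<omega>" "\<alpha> (Suc n) \<omega>" "e / 2" "\<beta> \<omega>" "e / 2"] by simp
    qed
    then have "norm (T \<beta> \<omega> - \<beta> \<omega>) \<le> 0" by (rule field_le_epsilon)
    then show ?thesis by simp
  qed
  with sq\<beta> that[of \<beta>] show thesis by blast
qed

section \<open>The fixed-point equation\<close>

text \<open>The balance that makes the fixed-point map a contraction is \<open>c\<^sub>1 < c\<^sub>0\<close>: the gradient in the control
  reacts to the law of the controls, in the bound \<open>contr\<close>, less than it grows in the control itself.\<close>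

locale lagrangian_game =
  fixes M :: "'w measure"
    and L :: "real^'d \<Rightarrow> real^'d \<Rightarrow> ((real^'d) \<times> (real^'d)) measure \<Rightarrow> real"
    and C_Lip c\<^sub>0 c\<^sub>1 C :: real
  assumes atomless: "atomless_prob_space M"
    and diff_a: "\<And>x a \<rho>. \<rho> \<in> P2 \<Longrightarrow> (\<lambda>a'. L x a' \<rho>) differentiable (at a)"
    and Lip_a: "\<And>x a \<rho> x' a' \<rho>'. \<rho> \<in> P2 \<Longrightarrow> \<rho>' \<in> P2 \<Longrightarrow>
      norm (La L x a \<rho> - La L x' a' \<rho>') \<le> C_Lip * (norm (x - x') + norm (a - a') + wasserstein 1 \<rho> \<rho>')"
    and c0: "0 < c\<^sub>0"
    and convex: "\<And>x a\<^sub>1 a\<^sub>2 \<rho>. \<rho> \<in> P2 \<Longrightarrow>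
      L x a\<^sub>2 \<rho> - L x a\<^sub>1 \<rho> - La L x a\<^sub>1 \<rho> \<bullet> (a\<^sub>2 - a\<^sub>1) \<ge> c\<^sub>0 / 2 * (norm (a\<^sub>2 - a\<^sub>1))\<^sup>2"
    and c1: "c\<^sub>1 < c\<^sub>0" and C: "0 < C"
    and contr: "\<And>x a X\<^sub>1 X\<^sub>2 \<alpha>\<^sub>1 \<alpha>\<^sub>2.
      square_integrable M X\<^sub>1 \<Longrightarrow> square_integrable M X\<^sub>2 \<Longrightarrow>
      square_integrable M \<alpha>\<^sub>1 \<Longrightarrow> square_integrable M \<alpha>\<^sub>2 \<Longrightarrow>
      norm (La L x a (law M (\<lambda>\<omega>. (X\<^sub>1 \<omega>, \<alpha>\<^sub>1 \<omega>))) - La L x a (law M (\<lambda>\<omega>. (X\<^sub>2 \<omega>, \<alpha>\<^sub>2 \<omega>))))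
        \<le> C * (LINT \<omega>|M. norm (X\<^sub>1 \<omega> - X\<^sub>2 \<omega>)) + c\<^sub>1 * (LINT \<omega>|M. norm (\<alpha>\<^sub>1 \<omega> - \<alpha>\<^sub>2 \<omega>))"
begin

sublocale prob_space M
  using atomless by (simp add: atomless_prob_space_def)

lemma convex_in_control:
  assumes "\<rho> \<in> P2"
  shows "strongly_convex_grad c\<^sub>0 (\<lambda>a. L x a \<rho>)"
  using diff_a convex c0 assms by (auto simp: strongly_convex_grad_def La_def)

lemma hamiltonian_eq_legendre: "(\<lambda>p. hamiltonian L x p \<rho>) = legendre (\<lambda>a. L x a \<rho>)"
  by (simp add: fun_eq_iff hamiltonian_def legendre_def)

lemma Hp_eq_grad_legendre: "Hp L x p \<rho> = grad (legendre (\<lambda>a. L x a \<rho>)) p"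
  by (simp add: Hp_def hamiltonian_eq_legendre)

lemma hamiltonian_differentiable:
  assumes "\<rho> \<in> P2"
  shows "(\<lambda>p. hamiltonian L x p \<rho>) differentiable (at p)"
  unfolding hamiltonian_eq_legendre by (rule legendre_grad_equation(1)[OF convex_in_control[OF assms]])

text \<open>The control \<open>a\<close> at which the two measures are compared is the one that is optimal for the second
  set of arguments. Only its existence is recorded, because the bound that will be applied to the last
  term is uniform in the control.\<close>

lemma Hp_stability:
  assumes "\<rho> \<in> P2" "\<rho>' \<in> P2"
  shows "\<exists>a. c\<^sub>0 * norm (Hp L x p \<rho> - Hp L x' p' \<rho>')
    \<le> norm (p - p') + \<bar>C_Lip\<bar> * norm (x - x') + norm (La L x' a \<rho> - La L x' a \<rho>')"
proof
  let ?a = "Hp L x' p' \<rho>'"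
  have "norm (La L x ?a \<rho> - La L x' ?a \<rho>) \<le> C_Lip * norm (x - x')"
    using Lip_a[OF assms(1,1), of x ?a x' ?a] wasserstein_1_self[OF assms(1)] by simp
  also have "\<dots> \<le> \<bar>C_Lip\<bar> * norm (x - x')" by (intro mult_right_mono) auto
  finally have "norm (La L x ?a \<rho> - La L x' ?a \<rho>') \<le> \<bar>C_Lip\<bar> * norm (x - x') + norm (La L x' ?a \<rho> - La L x' ?a \<rho>')"
    using norm_triangle_ineq[of "La L x ?a \<rho> - La L x' ?a \<rho>" "La L x' ?a \<rho> - La L x' ?a \<rho>'"] by simp
  with legendre_grad_stability[OF convex_in_control[OF assms(1), of x] convex_in_control[OF assms(2), of x'], of p p']
  show "c\<^sub>0 * norm (Hp L x p \<rho> - Hp L x' p' \<rho>')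
    \<le> norm (p - p') + \<bar>C_Lip\<bar> * norm (x - x') + norm (La L x' ?a \<rho> - La L x' ?a \<rho>')"
    by (simp add: La_def flip: Hp_eq_grad_legendre)
qed

lemma Hp_lipschitz:
  assumes "\<rho> \<in> P2"
  shows "norm (Hp L (fst z) (snd z) \<rho> - Hp L (fst z') (snd z') \<rho>) \<le> (1 + \<bar>C_Lip\<bar>) / c\<^sub>0 * norm (z - z')"
proof -
  have "c\<^sub>0 * norm (Hp L (fst z) (snd z) \<rho> - Hp L (fst z') (snd z') \<rho>)
      \<le> norm (snd z - snd z') + \<bar>C_Lip\<bar> * norm (fst z - fst z')"
    using Hp_stability[OF assms assms, of "fst z" "snd z" "fst z'" "snd z'"] by auto
  also have "\<dots> \<le> norm (z - z') + \<bar>C_Lip\<bar> * norm (z - z')"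
    using dist_fst_le[of z z'] dist_snd_le[of z z'] unfolding dist_norm
    by (intro add_mono mult_left_mono) auto
  finally show ?thesis using c0 by (simp add: field_simps)
qed

lemma Hp_measurable:
  assumes "\<rho> \<in> P2"
  shows "(\<lambda>z. Hp L (fst z) (snd z) \<rho>) \<in> borel_measurable borel"
proof (rule borel_measurable_continuous_onI)
  have "((1 + \<bar>C_Lip\<bar>) / c\<^sub>0)-lipschitz_on UNIV (\<lambda>z. Hp L (fst z) (snd z) \<rho>)"
    using Hp_lipschitz[OF assms] c0 by (intro lipschitz_onI) (auto simp: dist_norm)
  then show "continuous_on UNIV (\<lambda>z. Hp L (fst z) (snd z) \<rho>)"
    by (rule lipschitz_on_continuous_on)
qed

lemma Hp_square_integrable:
  assumes \<rho>: "\<rho> \<in> P2" and XY: "square_integrable M X" "square_integrable M Y"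
  shows "square_integrable M (\<lambda>\<omega>. Hp L (X \<omega>) (Y \<omega>) \<rho>)"
proof -
  let ?B = "(1 + \<bar>C_Lip\<bar>) / c\<^sub>0"
  have sq: "square_integrable M (\<lambda>\<omega>. (X \<omega>, Y \<omega>))" using XY by (simp add: square_integrable_Pair)
  then have "(\<lambda>\<omega>. (X \<omega>, Y \<omega>)) \<in> borel_measurable M" by (simp add: square_integrable_def)
  from measurable_compose[OF this Hp_measurable[OF \<rho>]]
  have meas: "(\<lambda>\<omega>. Hp L (X \<omega>) (Y \<omega>) \<rho>) \<in> borel_measurable M" by simp
  have "norm (Hp L (X \<omega>) (Y \<omega>) \<rho>) \<le> norm (norm (Hp L 0 0 \<rho>) + ?B *\<^sub>R norm (X \<omega>, Y \<omega>))" for \<omega>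
    using Hp_lipschitz[OF \<rho>, of "(X \<omega>, Y \<omega>)" "(0, 0)"] c0
      norm_triangle_ineq[of "Hp L (X \<omega>) (Y \<omega>) \<rho> - Hp L 0 0 \<rho>" "Hp L 0 0 \<rho>"]
    by simp
  with square_integrable_add[OF square_integrable_const square_integrable_scaleR[OF square_integrable_norm[OF sq]]] meas
  show ?thesis by (rule square_integrable_dominated)
qed

text \<open>The constant \<open>c\<^sub>1\<close> may be negative. Its nonnegative part is still below \<open>c\<^sub>0\<close>, and divided by \<open>c\<^sub>0\<close>
  it is the factor by which the fixed-point map contracts.\<close>

definition contraction_const :: real where
  "contraction_const = max c\<^sub>1 0"

lemma contraction_const: "0 \<le> contraction_const" "contraction_const < c\<^sub>0" "c\<^sub>1 \<le> contraction_const"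
  using c0 c1 by (auto simp: contraction_const_def)

text \<open>If the controls \<open>\<alpha>\<close> are played, \<open>\<partial>\<^sub>pH\<close> evaluated at their joint law with the states is the optimal
  reply. A solution of the fixed-point equation is the law of \<open>(X, \<alpha>)\<close> for an \<open>\<alpha>\<close> that replies to itself.\<close>

definition best_response ::
  "('w \<Rightarrow> real^'d) \<Rightarrow> ('w \<Rightarrow> real^'d) \<Rightarrow> ('w \<Rightarrow> real^'d) \<Rightarrow> 'w \<Rightarrow> real^'d" where
  "best_response X Y \<alpha> \<omega> = Hp L (X \<omega>) (Y \<omega>) (law M (\<lambda>\<omega>. (X \<omega>, \<alpha> \<omega>)))"

lemma law_Pair_in_P2:
  fixes X Y :: "'w \<Rightarrow> real^'d"
  assumes "square_integrable M X" "square_integrable M Y"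
  shows "law M (\<lambda>\<omega>. (X \<omega>, Y \<omega>)) \<in> P2"
  using assms square_integrable_Pair[of M X Y] law_in_P2_iff[OF prob_space_axioms, of "\<lambda>\<omega>. (X \<omega>, Y \<omega>)"]
  by (auto simp: square_integrable_def)

lemma best_response_square_integrable:
  assumes "square_integrable M X" "square_integrable M Y" "square_integrable M \<alpha>"
  shows "square_integrable M (best_response X Y \<alpha>)"
  using Hp_square_integrable[OF law_Pair_in_P2[OF assms(1,3)] assms(1,2)]
  by (simp add: best_response_def[abs_def])

text \<open>The controls enter the reply only through a law, so their distance appears as a mean, while the bound
  holds at each \<open>\<omega>\<close>.\<close>

lemma best_response_stability:
  assumes X: "square_integrable M X" "square_integrable M X'"
    and \<alpha>: "square_integrable M \<alpha>" "square_integrable M \<alpha>'"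
  shows "c\<^sub>0 * norm (best_response X Y \<alpha> \<omega> - best_response X' Y' \<alpha>' \<omega>)
    \<le> norm (Y \<omega> - Y' \<omega>) + \<bar>C_Lip\<bar> * norm (X \<omega> - X' \<omega>)
      + C * (LINT \<omega>|M. norm (X \<omega> - X' \<omega>)) + contraction_const * (LINT \<omega>|M. norm (\<alpha> \<omega> - \<alpha>' \<omega>))"
proof -
  let ?\<rho> = "law M (\<lambda>\<omega>. (X \<omega>, \<alpha> \<omega>))" and ?\<rho>' = "law M (\<lambda>\<omega>. (X' \<omega>, \<alpha>' \<omega>))"
  obtain a where "c\<^sub>0 * norm (Hp L (X \<omega>) (Y \<omega>) ?\<rho> - Hp L (X' \<omega>) (Y' \<omega>) ?\<rho>')
    \<le> norm (Y \<omega> - Y' \<omega>) + \<bar>C_Lip\<bar> * norm (X \<omega> - X' \<omega>) + norm (La L (X' \<omega>) a ?\<rho> - La L (X' \<omega>) a ?\<rho>')"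
    using Hp_stability[OF law_Pair_in_P2 law_Pair_in_P2] X \<alpha> by meson
  moreover have "c\<^sub>1 * (LINT \<omega>|M. norm (\<alpha> \<omega> - \<alpha>' \<omega>)) \<le> contraction_const * (LINT \<omega>|M. norm (\<alpha> \<omega> - \<alpha>' \<omega>))"
    using contraction_const(3) by (intro mult_right_mono) auto
  ultimately show ?thesis
    using contr[OF X \<alpha>, of "X' \<omega>" a] by (simp add: best_response_def)
qed

text \<open>Integrate the stability bound and absorb the distance of the controls on the left, which is possible
  because the contraction constant is below \<open>c\<^sub>0\<close>.\<close>

lemma best_response_fixed_points_dist:
  assumes X: "square_integrable M X" "square_integrable M X'"
    and Y: "square_integrable M Y" "square_integrable M Y'"
    and \<alpha>: "square_integrable M \<alpha>" "square_integrable M \<alpha>'"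
    and fixed: "best_response X Y \<alpha> = \<alpha>" "best_response X' Y' \<alpha>' = \<alpha>'"
  shows "(c\<^sub>0 - contraction_const) * (LINT \<omega>|M. norm (\<alpha> \<omega> - \<alpha>' \<omega>))
    \<le> (LINT \<omega>|M. norm (Y \<omega> - Y' \<omega>)) + (\<bar>C_Lip\<bar> + C) * (LINT \<omega>|M. norm (X \<omega> - X' \<omega>))"
proof -
  have [simp]: "integrable M (\<lambda>\<omega>. norm (Z \<omega> - Z' \<omega>))"
    if "square_integrable M Z" "square_integrable M Z'" for Z Z' :: "'w \<Rightarrow> real^'d"
    by (intro square_integrable_imp_integrable square_integrable_norm square_integrable_diff that)
  let ?A = "LINT \<omega>|M. norm (\<alpha> \<omega> - \<alpha>' \<omega>)" and ?X = "LINT \<omega>|M. norm (X \<omega> - X' \<omega>)"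
    and ?Y = "LINT \<omega>|M. norm (Y \<omega> - Y' \<omega>)"
  have "(LINT \<omega>|M. c\<^sub>0 * norm (\<alpha> \<omega> - \<alpha>' \<omega>))
    \<le> (LINT \<omega>|M. norm (Y \<omega> - Y' \<omega>) + \<bar>C_Lip\<bar> * norm (X \<omega> - X' \<omega>) + (C * ?X + contraction_const * ?A))"
    using best_response_stability[OF X \<alpha>, of Y _ Y'] X Y \<alpha>
    by (intro integral_mono) (simp_all add: fixed add.assoc)
  also have "\<dots> = ?Y + \<bar>C_Lip\<bar> * ?X + (C * ?X + contraction_const * ?A)"
    using X Y by (simp add: prob_space)
  finally show ?thesis by (simp add: algebra_simps)
qed

lemma best_response_fixed_point:
  assumes X: "square_integrable M X" and Y: "square_integrable M Y"
  obtains \<alpha> where "square_integrable M \<alpha>" "best_response X Y \<alpha> = \<alpha>"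
proof (rule uniform_contraction_fixed_point[of "best_response X Y" "contraction_const / c\<^sub>0"])
  show "square_integrable M (best_response X Y \<alpha>)" if "square_integrable M \<alpha>" for \<alpha>
    using best_response_square_integrable[OF X Y that] .
  show "norm (best_response X Y \<alpha> \<omega> - best_response X Y \<beta> \<omega>)
      \<le> contraction_const / c\<^sub>0 * (LINT \<omega>|M. norm (\<alpha> \<omega> - \<beta> \<omega>))"
    if "square_integrable M \<alpha>" "square_integrable M \<beta>" for \<alpha> \<beta> \<omega>
    using best_response_stability[OF X X that, of Y \<omega> Y] c0 by (simp add: field_simps)
qed (use contraction_const c0 that in auto)

text \<open>The mean distance of two fixed points vanishes by the previous bound; the pointwise stability bound
  then shows that they agree everywhere.\<close>

lemma best_response_fixed_point_unique:
  assumes XY: "square_integrable M X" "square_integrable M Y"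
    and \<alpha>: "square_integrable M \<alpha>" "square_integrable M \<alpha>'"
    and fixed: "best_response X Y \<alpha> = \<alpha>" "best_response X Y \<alpha>' = \<alpha>'"
  shows "\<alpha> = \<alpha>'"
proof
  fix \<omega>
  let ?A = "LINT \<omega>|M. norm (\<alpha> \<omega> - \<alpha>' \<omega>)"
  have "(c\<^sub>0 - contraction_const) * ?A \<le> 0"
    using best_response_fixed_points_dist[OF XY(1,1) XY(2,2) \<alpha> fixed] by simp
  then have "?A \<le> 0" using contraction_const by (simp add: mult_le_0_iff)
  then have "contraction_const * ?A \<le> 0" using contraction_const by (simp add: mult_nonneg_nonpos)
  then have "c\<^sub>0 * norm (\<alpha> \<omega> - \<alpha>' \<omega>) \<le> 0"
    using best_response_stability[OF XY(1,1) \<alpha>, of Y \<omega> Y] by (simp add: fixed)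
  then show "\<alpha> \<omega> = \<alpha>' \<omega>" using c0 by (simp add: mult_le_0_iff)
qed

text \<open>This is the right-hand side of the fixed-point equation written without random variables, which shows
  that the equation depends on \<open>(X, Y)\<close> only through its law \<open>\<nu>\<close>.\<close>

definition response_law ::
  "((real^'d) \<times> (real^'d)) measure \<Rightarrow> ((real^'d) \<times> (real^'d)) measure \<Rightarrow> ((real^'d) \<times> (real^'d)) measure" where
  "response_law \<nu> \<rho> = distr \<nu> borel (\<lambda>z. (fst z, Hp L (fst z) (snd z) \<rho>))"

lemma response_law_law:
  assumes \<rho>: "\<rho> \<in> P2" and XY: "square_integrable M X" "square_integrable M Y"
  shows "response_law (law M (\<lambda>\<omega>. (X \<omega>, Y \<omega>))) \<rho> = law M (\<lambda>\<omega>. (X \<omega>, Hp L (X \<omega>) (Y \<omega>) \<rho>))"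
proof -
  have "(\<lambda>\<omega>. (X \<omega>, Y \<omega>)) \<in> borel_measurable M"
    using XY by (intro borel_measurable_Pair) (auto simp: square_integrable_def)
  moreover have "(\<lambda>z. (fst z, Hp L (fst z) (snd z) \<rho>)) \<in> borel_measurable borel"
    using Hp_measurable[OF \<rho>] by (intro borel_measurable_Pair) auto
  ultimately show ?thesis by (simp add: response_law_def distr_distr comp_def)
qed

text \<open>Fixed measures correspond to fixed controls: a fixed measure \<open>\<rho>\<close> is the law of \<open>X\<close> with the control
  \<open>\<partial>\<^sub>pH(X, Y, \<rho>)\<close>, which is then a best response to itself and hence equal to \<open>\<alpha>\<close>.\<close>

lemma response_law_fixed_iff:
  assumes XY: "square_integrable M X" "square_integrable M Y"
    and \<alpha>: "square_integrable M \<alpha>" "best_response X Y \<alpha> = \<alpha>" and \<rho>: "\<rho> \<in> P2"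
  shows "\<rho> = response_law (law M (\<lambda>\<omega>. (X \<omega>, Y \<omega>))) \<rho> \<longleftrightarrow> \<rho> = law M (\<lambda>\<omega>. (X \<omega>, \<alpha> \<omega>))"
proof
  assume \<rho>_eq: "\<rho> = response_law (law M (\<lambda>\<omega>. (X \<omega>, Y \<omega>))) \<rho>"
  define \<beta> where "\<beta> \<omega> = Hp L (X \<omega>) (Y \<omega>) \<rho>" for \<omega>
  have \<rho>\<beta>: "\<rho> = law M (\<lambda>\<omega>. (X \<omega>, \<beta> \<omega>))"
    unfolding \<beta>_def using \<rho>_eq response_law_law[OF \<rho> XY] by (rule trans)
  have "best_response X Y \<beta> = \<beta>"
    by (rule ext) (unfold best_response_def \<rho>\<beta>[symmetric], simp add: \<beta>_def)
  moreover have "square_integrable M \<beta>"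
    using Hp_square_integrable[OF \<rho> XY] by (simp add: \<beta>_def[abs_def])
  ultimately have "\<beta> = \<alpha>" using best_response_fixed_point_unique[OF XY] \<alpha> by blast
  with \<rho>\<beta> show "\<rho> = law M (\<lambda>\<omega>. (X \<omega>, \<alpha> \<omega>))" by simp
next
  assume \<rho>_eq: "\<rho> = law M (\<lambda>\<omega>. (X \<omega>, \<alpha> \<omega>))"
  have "Hp L (X \<omega>) (Y \<omega>) \<rho> = \<alpha> \<omega>" for \<omega>
    using fun_cong[OF \<alpha>(2), of \<omega>] unfolding best_response_def \<rho>_eq[symmetric] .
  then have "response_law (law M (\<lambda>\<omega>. (X \<omega>, Y \<omega>))) \<rho> = law M (\<lambda>\<omega>. (X \<omega>, \<alpha> \<omega>))"
    unfolding response_law_law[OF \<rho> XY] by simp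
  with \<rho>_eq show "\<rho> = response_law (law M (\<lambda>\<omega>. (X \<omega>, Y \<omega>))) \<rho>" by simp
qed

lemma obtains_representation:
  assumes "\<nu> \<in> P2"
  obtains X Y where "square_integrable M X" "square_integrable M Y"
    "\<nu> = law M (\<lambda>\<omega>. (X \<omega>, Y \<omega> :: real^'d) :: (real^'d) \<times> (real^'d))"
proof -
  have "prob_space \<nu>" "sets \<nu> = sets borel" using assms by (auto simp: P2_def)
  then obtain Z where Z: "Z \<in> borel_measurable M" "law M Z = \<nu>"
    using atomless_obtains_law[OF atomless] by blast
  then have "square_integrable M (\<lambda>\<omega>. (fst (Z \<omega>), snd (Z \<omega>)))"
    using assms law_in_P2_iff[OF prob_space_axioms Z(1)] by simp
  then show thesis
    using that[of "\<lambda>\<omega>. fst (Z \<omega>)" "\<lambda>\<omega>. snd (Z \<omega>)"] Z(2) unfolding square_integrable_Pair by simp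
qed

lemma response_law_ex1:
  assumes "\<nu> \<in> P2"
  shows "\<exists>!\<rho>. \<rho> \<in> P2 \<and> \<rho> = response_law \<nu> \<rho>"
proof -
  obtain X Y where XY: "square_integrable M X" "square_integrable M Y" and \<nu>: "\<nu> = law M (\<lambda>\<omega>. (X \<omega>, Y \<omega>))"
    by (rule obtains_representation[OF assms])
  obtain \<alpha> where \<alpha>: "square_integrable M \<alpha>" "best_response X Y \<alpha> = \<alpha>"
    by (rule best_response_fixed_point[OF XY])
  show ?thesis
    using response_law_fixed_iff[OF XY \<alpha>] law_Pair_in_P2[OF XY(1) \<alpha>(1)] unfolding \<nu> by blast
qed

definition equilibrium :: "((real^'d) \<times> (real^'d)) measure \<Rightarrow> ((real^'d) \<times> (real^'d)) measure" where
  "equilibrium \<nu> = (THE \<rho>. \<rho> \<in> P2 \<and> \<rho> = response_law \<nu> \<rho>)"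

lemma equilibrium:
  assumes "\<nu> \<in> P2"
  shows "equilibrium \<nu> \<in> P2" and "\<rho> \<in> P2 \<Longrightarrow> \<rho> = response_law \<nu> \<rho> \<longleftrightarrow> \<rho> = equilibrium \<nu>"
proof -
  have *: "equilibrium \<nu> \<in> P2 \<and> equilibrium \<nu> = response_law \<nu> (equilibrium \<nu>)"
    unfolding equilibrium_def by (rule theI'[OF response_law_ex1[OF assms]])
  then show "equilibrium \<nu> \<in> P2" by blast
  show "\<rho> = response_law \<nu> \<rho> \<longleftrightarrow> \<rho> = equilibrium \<nu>" if "\<rho> \<in> P2"
    using * that response_law_ex1[OF assms] by metis
qed

lemma equilibrium_law:
  assumes XY: "square_integrable M X" "square_integrable M Y"
    and \<alpha>: "square_integrable M \<alpha>" "best_response X Y \<alpha> = \<alpha>"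
  shows "equilibrium (law M (\<lambda>\<omega>. (X \<omega>, Y \<omega>))) = law M (\<lambda>\<omega>. (X \<omega>, \<alpha> \<omega>))"
proof -
  note \<rho> = law_Pair_in_P2[OF XY(1) \<alpha>(1)]
  have "law M (\<lambda>\<omega>. (X \<omega>, \<alpha> \<omega>)) = response_law (law M (\<lambda>\<omega>. (X \<omega>, Y \<omega>))) (law M (\<lambda>\<omega>. (X \<omega>, \<alpha> \<omega>)))"
    by (rule response_law_fixed_iff[OF XY \<alpha> \<rho>, THEN iffD2]) (rule refl)
  then show ?thesis
    by (rule equilibrium(2)[OF law_Pair_in_P2[OF XY] \<rho>, THEN iffD1, THEN sym])
qed

definition equilibrium_lipschitz_const :: real where
  "equilibrium_lipschitz_const = 1 + (1 + \<bar>C_Lip\<bar> + C) / (c\<^sub>0 - contraction_const)"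

text \<open>Realise both equilibria on the same probability space, over the given pair of random variables. Their
  joint law is a coupling whose cost is at most the mean distance of the states plus that of the
  controls.\<close>

lemma equilibrium_le_coupling:
  assumes sq: "square_integrable M Z" "square_integrable M Z'"
  shows "wasserstein 1 (equilibrium (law M Z)) (equilibrium (law M Z'))
    \<le> equilibrium_lipschitz_const * (LINT \<omega>|M. dist (Z \<omega>) (Z' \<omega>))"
proof -
  define X Y X' Y' where "X \<omega> = fst (Z \<omega>)" and "Y \<omega> = snd (Z \<omega>)"
    and "X' \<omega> = fst (Z' \<omega>)" and "Y' \<omega> = snd (Z' \<omega>)" for \<omega>
  have Z: "Z = (\<lambda>\<omega>. (X \<omega>, Y \<omega>))" "Z' = (\<lambda>\<omega>. (X' \<omega>, Y' \<omega>))"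
    by (auto simp: X_def Y_def X'_def Y'_def)
  have XY: "square_integrable M X" "square_integrable M Y" and XY': "square_integrable M X'" "square_integrable M Y'"
    using sq by (auto simp: Z square_integrable_Pair)
  obtain \<alpha> where \<alpha>: "square_integrable M \<alpha>" "best_response X Y \<alpha> = \<alpha>"
    by (rule best_response_fixed_point[OF XY])
  obtain \<alpha>' where \<alpha>': "square_integrable M \<alpha>'" "best_response X' Y' \<alpha>' = \<alpha>'"
    by (rule best_response_fixed_point[OF XY'])
  have eq: "equilibrium (law M Z) = law M (\<lambda>\<omega>. (X \<omega>, \<alpha> \<omega>))"
    unfolding Z by (rule equilibrium_law[OF XY \<alpha>])
  have eq': "equilibrium (law M Z') = law M (\<lambda>\<omega>. (X' \<omega>, \<alpha>' \<omega>))"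
    unfolding Z by (rule equilibrium_law[OF XY' \<alpha>'])
  have int: "integrable M (\<lambda>\<omega>. dist (V \<omega>) (V' \<omega>))"
    if "square_integrable M V" "square_integrable M V'" for V V' :: "'w \<Rightarrow> 'e::euclidean_space"
    unfolding dist_norm
    by (intro square_integrable_imp_integrable square_integrable_norm square_integrable_diff that)
  note ints = int[OF XY(1) XY'(1)] int[OF XY(2) XY'(2)] int[OF \<alpha>(1) \<alpha>'(1)] int[OF sq]
  let ?D = "LINT \<omega>|M. dist (Z \<omega>) (Z' \<omega>)"
  let ?X = "LINT \<omega>|M. dist (X \<omega>) (X' \<omega>)" and ?Y = "LINT \<omega>|M. dist (Y \<omega>) (Y' \<omega>)"
  let ?A = "LINT \<omega>|M. dist (\<alpha> \<omega>) (\<alpha>' \<omega>)"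
  have XD: "?X \<le> ?D" and YD: "?Y \<le> ?D"
    using ints by (auto intro!: integral_mono simp: X_def X'_def Y_def Y'_def dist_fst_le dist_snd_le)
  have "(c\<^sub>0 - contraction_const) * ?A \<le> ?Y + (\<bar>C_Lip\<bar> + C) * ?X"
    using best_response_fixed_points_dist[OF XY(1) XY'(1) XY(2) XY'(2) \<alpha>(1) \<alpha>'(1) \<alpha>(2) \<alpha>'(2)]
    by (simp add: dist_norm)
  also have "\<dots> \<le> ?D + (\<bar>C_Lip\<bar> + C) * ?D"
    using XD YD C by (intro add_mono mult_left_mono) auto
  finally have AD: "?A \<le> (1 + \<bar>C_Lip\<bar> + C) / (c\<^sub>0 - contraction_const) * ?D"
    using contraction_const by (simp add: field_simps)
  have sq\<alpha>: "square_integrable M (\<lambda>\<omega>. (X \<omega>, \<alpha> \<omega>))" "square_integrable M (\<lambda>\<omega>. (X' \<omega>, \<alpha>' \<omega>))"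
    using XY XY' \<alpha> \<alpha>' by (auto simp: square_integrable_Pair)
  have "wasserstein 1 (equilibrium (law M Z)) (equilibrium (law M Z'))
      \<le> (LINT \<omega>|M. dist (X \<omega>, \<alpha> \<omega>) (X' \<omega>, \<alpha>' \<omega>))"
    unfolding eq eq' using sq\<alpha>
    by (intro wasserstein_1_law_le int) (auto simp: square_integrable_def)
  also have "\<dots> \<le> (LINT \<omega>|M. dist (X \<omega>) (X' \<omega>) + dist (\<alpha> \<omega>) (\<alpha>' \<omega>))"
    using ints int[OF sq\<alpha>] by (intro integral_mono) (auto simp: dist_Pair_Pair intro: sqrt_sum_squares_le_sum)
  also have "\<dots> = ?X + ?A" using ints by simp
  also have "\<dots> \<le> equilibrium_lipschitz_const * ?D"
    using XD AD by (simp add: equilibrium_lipschitz_const_def distrib_right)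
  finally show ?thesis .
qed

lemma equilibrium_lipschitz:
  assumes "\<nu> \<in> P2" "\<nu>' \<in> P2"
  shows "wasserstein 1 (equilibrium \<nu>) (equilibrium \<nu>') \<le> equilibrium_lipschitz_const * wasserstein 1 \<nu> \<nu>'"
proof -
  have pos: "0 < equilibrium_lipschitz_const"
    using C contraction_const by (auto simp: equilibrium_lipschitz_const_def intro!: add_pos_nonneg)
  have "wasserstein 1 (equilibrium \<nu>) (equilibrium \<nu>') / equilibrium_lipschitz_const \<le> wasserstein 1 \<nu> \<nu>'"
    using equilibrium_le_coupling pos
    by (intro le_wasserstein_1[OF atomless assms]) (auto simp: field_simps)
  then show ?thesis using pos by (simp add: field_simps)
qed

end

theorem proposition2p13:
  fixes M :: "'w measure"
    and L :: "real^'d \<Rightarrow> real^'d \<Rightarrow> ((real^'d) \<times> (real^'d)) measure \<Rightarrow> real"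
    and C_Lip c\<^sub>0 c\<^sub>1 C K :: real
  assumes M: "atomless_prob_space M"
    and diff_x: "\<And>x a \<rho>. \<rho> \<in> P2 \<Longrightarrow> (\<lambda>x'. L x' a \<rho>) differentiable (at x)"
    and diff_a: "\<And>x a \<rho>. \<rho> \<in> P2 \<Longrightarrow> (\<lambda>a'. L x a' \<rho>) differentiable (at a)"
    and Lip_x: "\<And>x a \<rho> x' a' \<rho>'. \<rho> \<in> P2 \<Longrightarrow> \<rho>' \<in> P2 \<Longrightarrow>
      norm (Lx L x a \<rho> - Lx L x' a' \<rho>') \<le> C_Lip * (norm (x - x') + norm (a - a') + wasserstein 1 \<rho> \<rho>')"
    and Lip_a: "\<And>x a \<rho> x' a' \<rho>'. \<rho> \<in> P2 \<Longrightarrow> \<rho>' \<in> P2 \<Longrightarrow>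
      norm (La L x a \<rho> - La L x' a' \<rho>') \<le> C_Lip * (norm (x - x') + norm (a - a') + wasserstein 1 \<rho> \<rho>')"
    and c0: "0 < c\<^sub>0"
    and convex: "\<And>x a\<^sub>1 a\<^sub>2 \<rho>. \<rho> \<in> P2 \<Longrightarrow>
      L x a\<^sub>2 \<rho> - L x a\<^sub>1 \<rho> - La L x a\<^sub>1 \<rho> \<bullet> (a\<^sub>2 - a\<^sub>1) \<ge> c\<^sub>0 / 2 * (norm (a\<^sub>2 - a\<^sub>1))\<^sup>2"
    and c1: "c\<^sub>1 < c\<^sub>0" and C: "0 < C"
    and contr: "\<And>x a X\<^sub>1 X\<^sub>2 \<alpha>\<^sub>1 \<alpha>\<^sub>2.
      square_integrable M X\<^sub>1 \<Longrightarrow> square_integrable M X\<^sub>2 \<Longrightarrow>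
      square_integrable M \<alpha>\<^sub>1 \<Longrightarrow> square_integrable M \<alpha>\<^sub>2 \<Longrightarrow>
      norm (La L x a (law M (\<lambda>\<omega>. (X\<^sub>1 \<omega>, \<alpha>\<^sub>1 \<omega>))) - La L x a (law M (\<lambda>\<omega>. (X\<^sub>2 \<omega>, \<alpha>\<^sub>2 \<omega>))))
        \<le> C * (LINT \<omega>|M. norm (X\<^sub>1 \<omega> - X\<^sub>2 \<omega>)) + c\<^sub>1 * (LINT \<omega>|M. norm (\<alpha>\<^sub>1 \<omega> - \<alpha>\<^sub>2 \<omega>))"
    and K: "0 < K"
    and lower: "\<And>x a \<rho>. \<rho> \<in> P2 \<Longrightarrow>
      1 / K * (norm a)\<^sup>2 - K * (1 + (norm x)\<^sup>2 + wasserstein 2 \<rho> (return borel (0, 0))) \<le> L x a \<rho>"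
    and upper: "\<And>x a \<rho>. \<rho> \<in> P2 \<Longrightarrow>
      L x a \<rho> \<le> K * (norm a)\<^sup>2 + K * (1 + (norm x)\<^sup>2 + wasserstein 2 \<rho> (return borel (0, 0)))"
  shows "(\<forall>x p. \<forall>\<rho>\<in>P2. (\<lambda>p'. hamiltonian L x p' \<rho>) differentiable (at p)) \<and>
    (\<forall>X Y. \<forall>\<rho>\<in>P2. square_integrable M X \<longrightarrow> square_integrable M Y \<longrightarrow>
       square_integrable M (\<lambda>\<omega>. Hp L (X \<omega>) (Y \<omega>) \<rho>)) \<and>
    (\<exists>\<Phi>. (\<forall>\<nu>\<in>P2. \<Phi> \<nu> \<in> P2) \<and>
      (\<forall>\<nu>\<in>P2. \<forall>X Y. square_integrable M X \<longrightarrow> square_integrable M Y \<longrightarrow> \<nu> = law M (\<lambda>\<omega>. (X \<omega>, Y \<omega>)) \<longrightarrow>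
         (\<forall>\<rho>\<in>P2. \<rho> = law M (\<lambda>\<omega>. (X \<omega>, Hp L (X \<omega>) (Y \<omega>) \<rho>)) \<longleftrightarrow> \<rho> = \<Phi> \<nu>)) \<and>
      (\<exists>C'. \<forall>\<nu>\<^sub>1\<in>P2. \<forall>\<nu>\<^sub>2\<in>P2. wasserstein 1 (\<Phi> \<nu>\<^sub>1) (\<Phi> \<nu>\<^sub>2) \<le> C' * wasserstein 1 \<nu>\<^sub>1 \<nu>\<^sub>2))"
proof -
  interpret lagrangian_game M L C_Lip c\<^sub>0 c\<^sub>1 C
    by unfold_locales (fact M diff_a Lip_a c0 convex c1 C contr)+
  have "\<rho> = law M (\<lambda>\<omega>. (X \<omega>, Hp L (X \<omega>) (Y \<omega>) \<rho>)) \<longleftrightarrow> \<rho> = equilibrium \<nu>"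
    if "\<nu> \<in> P2" "\<rho> \<in> P2" "square_integrable M X" "square_integrable M Y" "\<nu> = law M (\<lambda>\<omega>. (X \<omega>, Y \<omega>))"
    for X Y \<nu> \<rho>
    using equilibrium(2)[OF that(1,2)] response_law_law[OF that(2-4)] that(5) by simp
  then show ?thesis
    using hamiltonian_differentiable Hp_square_integrable equilibrium(1) equilibrium_lipschitz
    by (intro conjI exI[of _ equilibrium] exI[of _ equilibrium_lipschitz_const] ballI allI impI)
qed

end
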